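(* Let $\Bbbk$ be a field and $S = \Bbbk[x,y,z,w]$. The monomial ideal $I = \langle x^2, xy, y^2z^2, zw, w^2 \rangle \subseteq S$ is strongly generic, but the minimal free resolution of $S/I$ over $S$ does not admit the structure of a DGA whose multiplication respects the standard $\mathbb{Z}$-grading.
   Context: A monomial ideal is strongly generic if no variable appears with the same nonzero exponent in two distinct minimal monomial generators of the ideal. Let $\mathbb{F}$ be the minimal graded free resolution of $S/I$ with $\mathbb{F}_0=S$ and differential $\partial$, identified with $\bigoplus_i \mathbb{F}_i$; $|f|$ denotes the homological degree. A DGA structure on $\mathbb{F}$ is an $S$-linear map $* : \mathbb{F} \otimes_S \mathbb{F} \to \mathbb{F}$ such that for all (homologically homogeneous) $a,b,c\in\mathbb{F}$: (1) $*$ extends the usual multiplication on $\mathbb{F}_0 = S$ and $1 \in \mathbb{F}_0$ acts as the identity; (2) $\partial(a*b) = \partial(a)*b + (-1)^{|a|} a*\partial(b)$; (3) $|a*b| = |a|+|b|$; (4) $a*b = (-1)^{|a||b|} b*a$; (5) $(a*b)*c = a*(b*c)$. It respects the standard $\mathbb{Z}$-grading if for $a,b\in\mathbb{F}$ homogeneous with respect to the total (standard $\mathbb{Z}$-) degree, $a*b$ is homogeneous of total degree equal to the sum of the total degrees of $a$ and $b$; it is not required to respect the $\mathbb{Z}^4$-grading. *)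

theory Defs
  imports Complex_Main "HOL-Library.Poly_Mapping"
begin

text \<open>
  The polynomial ring with coefficients in \<open>'k\<close> and variables indexed by \<open>'v\<close> is the ring of
  finitely supported functions from exponent vectors to \<open>'k\<close>, with convolution as product.
\<close>

type_synonym ('v, 'k) mpoly = "('v \<Rightarrow>\<^sub>0 nat) \<Rightarrow>\<^sub>0 'k"

datatype indet = Vx | Vy | Vz | Vw

definition monomial :: "('v \<Rightarrow>\<^sub>0 nat) \<Rightarrow> ('v, 'k::comm_ring_1) mpoly" where
  "monomial t = Poly_Mapping.single t 1"

definition var :: "'v \<Rightarrow> ('v, 'k::comm_ring_1) mpoly" where
  "var v = monomial (Poly_Mapping.single v 1)"

definition mdeg :: "('v \<Rightarrow>\<^sub>0 nat) \<Rightarrow> nat" where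
  "mdeg t = (\<Sum>v\<in>Poly_Mapping.keys t. Poly_Mapping.lookup t v)"

definition ideal_gen :: "'a::comm_ring_1 set \<Rightarrow> 'a set" where
  "ideal_gen A = module.span (*) A"

definition minimal_monomial_generators ::
    "('v, 'k::comm_ring_1) mpoly set \<Rightarrow> ('v \<Rightarrow>\<^sub>0 nat) set \<Rightarrow> bool" where
  "minimal_monomial_generators I G \<longleftrightarrow>
     ideal_gen (monomial ` G) = I \<and> (\<forall>H. H \<subset> G \<longrightarrow> ideal_gen (monomial ` H) \<noteq> I)"

text \<open>
  Only monomial ideals have a set \<open>G\<close> as below, and a monomial ideal has exactly one, so the
  existential quantifier merely names it.
\<close>

definition strongly_generic :: "('v, 'k::comm_ring_1) mpoly set \<Rightarrow> bool" where
  "strongly_generic I \<longleftrightarrow>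
     (\<exists>G. minimal_monomial_generators I G \<and>
       (\<forall>s\<in>G. \<forall>t\<in>G. s \<noteq> t \<longrightarrow>
         \<not> (\<exists>v. Poly_Mapping.lookup s v \<noteq> 0 \<and>
               Poly_Mapping.lookup s v = Poly_Mapping.lookup t v)))"

text \<open>
  A homologically and internally graded free module over the polynomial ring: the whole type
  \<open>'m\<close> is free on \<open>B\<close>, and a basis element \<open>b\<close> has homological degree \<open>hdeg b\<close> and total degree
  \<open>tdeg b\<close>.  The component \<open>comp i\<close> plays the role of the \<open>i\<close>-th module of the complex, and
  \<open>homog n\<close> is the set of elements that are homogeneous of total degree \<open>n\<close> in the standard
  grading: \<open>representation B m b\<close> is the coefficient of \<open>m\<close> at \<open>b\<close>, and it has to be
  homogeneous of degree \<open>n - tdeg b\<close>.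
\<close>

locale graded_free_module = module scale
  for scale :: "('v, 'k::field) mpoly \<Rightarrow> 'm::ab_group_add \<Rightarrow> 'm" +
  fixes B :: "'m set"
    and hdeg :: "'m \<Rightarrow> nat"
    and tdeg :: "'m \<Rightarrow> int"
  assumes independent_basis: "independent B"
    and span_basis: "span B = UNIV"
    and finite_basis: "finite {b \<in> B. hdeg b = i}"
begin

definition comp :: "nat \<Rightarrow> 'm set" where
  "comp i = span {b \<in> B. hdeg b = i}"

definition homog :: "int \<Rightarrow> 'm set" where
  "homog n =
     {m. \<forall>b\<in>B. \<forall>t\<in>Poly_Mapping.keys (representation B m b). int (mdeg t) + tdeg b = n}"

end

text \<open>
  A minimal graded free resolution of the quotient of the polynomial ring by \<open>I\<close>, viewed as the
  direct sum of its components.  The component of homological degree \<open>0\<close> is free on \<open>e\<close>, of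
  total degree \<open>0\<close>, and is identified with the polynomial ring through \<open>p \<mapsto> scale p e\<close>.
  Minimality says that the image of \<open>d\<close> lies in \<open>\<mm>F\<close>, \<open>\<mm>\<close> being the ideal generated by the
  variables.
\<close>

locale minimal_graded_free_resolution = graded_free_module scale B hdeg tdeg
  for scale :: "('v, 'k::field) mpoly \<Rightarrow> 'm::ab_group_add \<Rightarrow> 'm"
    and B :: "'m set"
    and hdeg :: "'m \<Rightarrow> nat"
    and tdeg :: "'m \<Rightarrow> int" +
  fixes e :: 'm
    and d :: "'m \<Rightarrow> 'm"
    and I :: "('v, 'k) mpoly set"
  assumes basis_0: "{b \<in> B. hdeg b = 0} = {e}"
    and tdeg_e: "tdeg e = 0"
    and d_linear: "module_hom scale scale d"
    and d_comp: "d ` comp (Suc i) \<subseteq> comp i"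
    and d_homog: "d ` homog n \<subseteq> homog n"
    and d_0: "d e = 0"
    and exact_0: "d ` comp 1 = (\<lambda>p. scale p e) ` I"
    and exact_Suc: "{m \<in> comp (Suc i). d m = 0} = d ` comp (Suc (Suc i))"
    and minimal: "range d \<subseteq> span {scale (var v) m | v m. True}"
begin

definition dga_structure :: "('m \<Rightarrow> 'm \<Rightarrow> 'm) \<Rightarrow> bool" where
  "dga_structure mul \<longleftrightarrow>
     (\<forall>a. module_hom scale scale (\<lambda>b. mul a b)) \<and>
     (\<forall>b. module_hom scale scale (\<lambda>a. mul a b)) \<and>
     (\<forall>p q. mul (scale p e) (scale q e) = scale (p * q) e) \<and>
     (\<forall>a. mul e a = a \<and> mul a e = a) \<and>
     (\<forall>i j. \<forall>a\<in>comp i. \<forall>b\<in>comp j.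
        d (mul a b) = mul (d a) b + scale ((-1) ^ i) (mul a (d b))) \<and>
     (\<forall>i j. \<forall>a\<in>comp i. \<forall>b\<in>comp j. mul a b \<in> comp (i + j)) \<and>
     (\<forall>i j. \<forall>a\<in>comp i. \<forall>b\<in>comp j. mul a b = scale ((-1) ^ (i * j)) (mul b a)) \<and>
     (\<forall>a b c. mul (mul a b) c = mul a (mul b c))"

definition respects_standard_grading :: "('m \<Rightarrow> 'm \<Rightarrow> 'm) \<Rightarrow> bool" where
  "respects_standard_grading mul \<longleftrightarrow>
     (\<forall>n k. \<forall>a\<in>homog n. \<forall>b\<in>homog k. mul a b \<in> homog (n + k))"

end

end

theory Submission
  imports Defs
begin

text \<open>
  Write \<open>F\<close> for the resolution.  The generators \<open>x\<^sup>2, xy, y\<^sup>2z\<^sup>2, zw, w\<^sup>2\<close> of the ideal lift to homogeneous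
  elements \<open>a1, \<dots>, a5\<close> of \<open>F\<^sub>1\<close>, and the eight edges of the Scarf complex lift to homogeneous elements
  \<open>aij\<close> of \<open>F\<^sub>2\<close>.  In a multigraded algebra the product \<open>a1 * a3\<close> would have to be
  \<open>x a23 + yz\<^sup>2 a12\<close>, and \<open>a3 * a5\<close> would have to be \<open>w a34 + y\<^sup>2z a45\<close>.  Associativity of
  \<open>a1 * a3 * a5\<close> would then say that
    \<open>x (a23 * a5) + yz\<^sup>2 (a12 * a5) = w (a1 * a34) + y\<^sup>2z (a1 * a45)\<close>.
  Modulo the ideal generated by \<open>x\<close>, \<open>w\<close> and \<open>y\<^sup>2\<close> only \<open>yz\<^sup>2 (a12 * a5)\<close> remains, whereas
  \<open>a12 * a5\<close> is a minimal generator of \<open>F\<^sub>3\<close>.  This is impossible.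

  A multiplication that respects only the total degree may change \<open>a1 * a3\<close> and \<open>a3 * a5\<close> by cycles
  \<open>X\<close> and \<open>Y\<close> of \<open>F\<^sub>2\<close>, which adds \<open>X * a5\<close> to the left side and \<open>a1 * Y\<close> to the right side.  The
  argument survives because both corrections lie in \<open>(x, w) F\<^sub>3\<close>, for every pair of cycles
  (\<open>cycle_mul_a5\<close>, \<open>a1_mul_cycle\<close>).  There are two reasons for this.  The coefficients of a cycle
  at those edges whose product with \<open>a5\<close> is unknown are themselves multiples of \<open>x\<close> or of \<open>w\<close>
  (\<open>cycle_2_coefficients\<close>).  For the other edges the total degree does determine
  the product: \<open>F\<^sub>3\<close> has no basis element of degree below \<open>5\<close> (\<open>tdeg_3\<close>), so that an element of
  \<open>F\<^sub>2\<close> of degree \<open>4\<close> is determined by its boundary, and hence the edge \<open>a14\<close>, for example, is the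
  product \<open>a1 * a4\<close>, and \<open>a4 * a5 = w a45\<close>.

  Again by \<open>tdeg_3\<close> the coordinates of \<open>a12 * a5\<close>, an element of degree \<open>5\<close>, are constants.
  Comparing the coefficients of the monomial \<open>yz\<^sup>2\<close> shows \<open>a12 * a5 = 0\<close> (\<open>a12_mul_a5\<close>).  Its boundary
  is \<open>x (a2 * a5) - y (a1 * a5) + w\<^sup>2 a12\<close>, and comparing the coefficients of \<open>w\<^sup>2\<close> gives \<open>a12 = 0\<close>,
  which contradicts \<open>\<partial> a12 = x a2 - y a1\<close>.

  All this uses the beginning of \<open>F\<close> only: \<open>F\<^sub>1\<close> is free on the \<open>ai\<close> and \<open>F\<^sub>2\<close> is spanned by the \<open>aij\<close>.
  Since \<open>F\<close> is given by an abstract basis, this is derived from exactness and minimality by a graded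
  Nakayama lemma (\<open>graded_Nakayama\<close>) together with the syzygies of the five monomials
  (\<open>example_syzygies\<close>).
\<close>

section \<open>Monomial ideals and homogeneous polynomials\<close>

lemma module_mult: "module ((*) :: 'a::comm_ring_1 \<Rightarrow> 'a \<Rightarrow> 'a)"
  by standard (simp_all add: algebra_simps)

lemma ideal_gen_insert:
  "p \<in> ideal_gen (insert a A) \<longleftrightarrow> (\<exists>q. p - q * a \<in> ideal_gen A)"
  unfolding ideal_gen_def by (rule module.span_breakdown_eq [OF module_mult])

lemma ideal_gen_empty: "p \<in> ideal_gen {} \<longleftrightarrow> p = 0"
  by (simp add: ideal_gen_def module.span_empty [OF module_mult])

lemma exponent_splits:
  fixes s t :: "'v \<Rightarrow>\<^sub>0 nat"
  assumes "\<forall>v. Poly_Mapping.lookup s v \<le> Poly_Mapping.lookup t v"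
  shows "t = (t - s) + s"
  using assms by (intro poly_mapping_eqI) (simp add: lookup_add lookup_minus)

lemma poly_as_sum:
  "p = (\<Sum>t\<in>Poly_Mapping.keys p. Poly_Mapping.single t (Poly_Mapping.lookup p t))"
proof (rule poly_mapping_eqI)
  fix k
  show "Poly_Mapping.lookup p k =
      Poly_Mapping.lookup (\<Sum>t\<in>Poly_Mapping.keys p.
        Poly_Mapping.single t (Poly_Mapping.lookup p t)) k"
    by (cases "k \<in> Poly_Mapping.keys p")
      (auto simp: lookup_sum lookup_single when_def in_keys_iff)
qed

lemma poly_induct [case_names zero single_plus]:
  assumes "P 0" and "\<And>t c p. P p \<Longrightarrow> P (Poly_Mapping.single t c + p)"
  shows "P (p :: 'b \<Rightarrow>\<^sub>0 'a::comm_monoid_add)"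
proof -
  have "P (\<Sum>t\<in>T. Poly_Mapping.single t (Poly_Mapping.lookup p t))" if "finite T" for T
    using that by (induction T rule: finite_induct) (auto intro: assms)
  from this [of "Poly_Mapping.keys p"] show ?thesis
    using poly_as_sum [of p] by simp
qed

text \<open>
  Membership in a monomial ideal is decided term by term.  Minimality of the five generators and all
  the divisibility steps in the syzygy computation come down to this criterion.
\<close>

lemma mem_monomial_ideal_iff:
  fixes p :: "('v, 'k::comm_ring_1) mpoly"
  shows "p \<in> ideal_gen (monomial ` G) \<longleftrightarrow>
    (\<forall>t\<in>Poly_Mapping.keys p. \<exists>s\<in>G. \<forall>v. Poly_Mapping.lookup s v \<le> Poly_Mapping.lookup t v)"
proof
  let ?P = "\<lambda>p :: ('v, 'k) mpoly. \<forall>t\<in>Poly_Mapping.keys p. \<exists>s\<in>G.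
    \<forall>v. Poly_Mapping.lookup s v \<le> Poly_Mapping.lookup t v"
  assume "p \<in> ideal_gen (monomial ` G)"
  then show "?P p"
    unfolding ideal_gen_def
  proof (induction rule: module.span_induct_alt [OF module_mult, consumes 1, case_names base step])
    case base
    show ?case by simp
  next
    case (step c x y)
    from step obtain g where g: "g \<in> G" "x = monomial g" by auto
    show ?case
    proof
      fix t assume "t \<in> Poly_Mapping.keys (c * x + y)"
      then consider "t \<in> Poly_Mapping.keys (c * x)" | "t \<in> Poly_Mapping.keys y"
        using Poly_Mapping.keys_add [of "c * x" y] by blast
      then show "\<exists>s\<in>G. \<forall>v. Poly_Mapping.lookup s v \<le> Poly_Mapping.lookup t v"
      proof cases
        case 1
        then obtain u where "t = u + g"
          using keys_mult [of c x] by (auto simp: g monomial_def split: if_splits)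
        then show ?thesis using g by (intro bexI [of _ g]) (simp_all add: lookup_add)
      next
        case 2
        then show ?thesis using step by blast
      qed
    qed
  qed
next
  assume *: "\<forall>t\<in>Poly_Mapping.keys p. \<exists>s\<in>G.
    \<forall>v. Poly_Mapping.lookup s v \<le> Poly_Mapping.lookup t v"
  have "Poly_Mapping.single t (Poly_Mapping.lookup p t) \<in> ideal_gen (monomial ` G)"
    if "t \<in> Poly_Mapping.keys p" for t
  proof -
    obtain s where s: "s \<in> G" "t = (t - s) + s"
      using * \<open>t \<in> Poly_Mapping.keys p\<close> exponent_splits by metis
    have "Poly_Mapping.single t (Poly_Mapping.lookup p t) =
        Poly_Mapping.single (t - s) (Poly_Mapping.lookup p t) * monomial s"
      using s(2) by (simp add: monomial_def mult_single)
    then show ?thesis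
      using s(1) unfolding ideal_gen_def by (auto intro: module.span_scale [OF module_mult] module.span_base [OF module_mult])
  qed
  then have "(\<Sum>t\<in>Poly_Mapping.keys p. Poly_Mapping.single t (Poly_Mapping.lookup p t))
      \<in> ideal_gen (monomial ` G)"
    unfolding ideal_gen_def by (rule module.span_sum [OF module_mult])
  then show "p \<in> ideal_gen (monomial ` G)"
    using poly_as_sum [of p] by simp
qed

lemma lookup_var_mult:
  fixes p :: "('v, 'k::comm_ring_1) mpoly"
  shows "Poly_Mapping.lookup (var v * p) t =
    (if Poly_Mapping.lookup t v = 0 then 0
     else Poly_Mapping.lookup p (t - Poly_Mapping.single v 1))"
proof (induction p rule: poly_induct)
  case zero
  show ?case by simp
next
  case (single_plus s c p)
  have eq_iff: "Poly_Mapping.single v 1 + s = t \<longleftrightarrow>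
      Poly_Mapping.lookup t v \<noteq> 0 \<and> s = t - Poly_Mapping.single v 1"
    (is "?l \<longleftrightarrow> ?r")
  proof
    assume ?r
    then have "\<forall>u. Poly_Mapping.lookup (Poly_Mapping.single v 1) u \<le> Poly_Mapping.lookup t u"
      by (auto simp: lookup_single when_def)
    from exponent_splits [OF this, symmetric] show ?l
      unfolding conjunct2 [OF \<open>?r\<close>] by (subst add.commute)
  qed (auto simp: lookup_add)
  have mult: "var v * Poly_Mapping.single s c = Poly_Mapping.single (Poly_Mapping.single v 1 + s) c"
    by (simp add: var_def monomial_def mult_single)
  show ?case
    unfolding distrib_left lookup_add single_plus.IH mult lookup_single when_def eq_iff by auto
qed

lemma var_mult_cancel:
  assumes "var v * p = (0 :: ('v, 'k::comm_ring_1) mpoly)"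
  shows "p = 0"
proof (rule poly_mapping_eqI)
  fix t
  have "Poly_Mapping.lookup (var v * p) (t + Poly_Mapping.single v 1) = Poly_Mapping.lookup p t"
    by (simp add: lookup_var_mult lookup_add)
  then show "Poly_Mapping.lookup p t = Poly_Mapping.lookup 0 t" using assms by simp
qed

lemma single_le_iff:
  "(\<forall>u. Poly_Mapping.lookup (Poly_Mapping.single v (n::nat)) u \<le> Poly_Mapping.lookup t u)
    \<longleftrightarrow> n \<le> Poly_Mapping.lookup t v"
  by (auto simp: lookup_single when_def)

lemma mult_constant_eq_0:
  fixes p :: "('v, 'k::field) mpoly"
  assumes "p * Poly_Mapping.single 0 c = 0" "c \<noteq> 0"
  shows "p = 0"
proof -
  have "p = p * Poly_Mapping.single 0 c * Poly_Mapping.single 0 (inverse c)"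
    using assms(2) by (simp add: mult.assoc mult_single)
  then show ?thesis using assms(1) by simp
qed

lemma lookup_mult_constant:
  fixes p :: "('v, 'k::field) mpoly"
  shows "Poly_Mapping.lookup (p * Poly_Mapping.single 0 c) t = Poly_Mapping.lookup p t * c"
proof (induction p rule: poly_induct)
  case (single_plus s a p)
  then show ?case
    by (simp add: distrib_right lookup_add mult_single lookup_single when_def)
qed simp

lemma mem_var_ideal:
  fixes p :: "('v, 'k::comm_ring_1) mpoly"
  assumes "\<And>t. Poly_Mapping.lookup t u = 0 \<Longrightarrow> Poly_Mapping.lookup t v = 0 \<Longrightarrow>
    Poly_Mapping.lookup p t = 0"
  shows "\<exists>q r. p = var u * q + var v * r"
proof -
  have "p \<in> ideal_gen (monomial ` {Poly_Mapping.single u 1, Poly_Mapping.single v 1})"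
    unfolding mem_monomial_ideal_iff using assms
    by (auto simp: single_le_iff in_keys_iff Suc_le_eq)
  then obtain q r where "p - q * monomial (Poly_Mapping.single u 1)
      - r * monomial (Poly_Mapping.single v 1) = 0"
    unfolding image_insert image_empty ideal_gen_insert ideal_gen_empty by blast
  then have "p = var u * q + var v * r"
    unfolding var_def by (simp add: algebra_simps)
  then show ?thesis by blast
qed

text \<open>
  The Koszul relation: distinct variables form a regular sequence.
\<close>

lemma var_syzygy:
  fixes f g :: "('v, 'k::comm_ring_1) mpoly"
  assumes "u \<noteq> v" and eq: "var u * f = var v * g"
  shows "\<exists>h. f = var v * h \<and> g = var u * h"
proof -
  have "Poly_Mapping.lookup f t = 0" if "Poly_Mapping.lookup t v = 0" for t
  proof -
    have "Poly_Mapping.lookup f t = Poly_Mapping.lookup (var u * f) (t + Poly_Mapping.single u 1)"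
      by (simp add: lookup_var_mult lookup_add)
    also have "\<dots> = 0"
      unfolding eq using that assms(1) by (auto simp: lookup_var_mult lookup_add lookup_single when_def)
    finally show ?thesis .
  qed
  then obtain q r where "f = var v * q + var v * r"
    using mem_var_ideal [of v v f] by blast
  then have f: "f = var v * (q + r)" by (simp add: distrib_left)
  have "var v * (g - var u * (q + r)) = var v * g - var u * f"
    unfolding f by (simp only: algebra_simps)
  also have "\<dots> = 0" unfolding eq by (rule diff_self)
  finally have "g - var u * (q + r) = 0" by (rule var_mult_cancel)
  then have "g = var u * (q + r)" by (simp only: right_minus_eq)
  with f show ?thesis by blast
qed

text \<open>
  The two hypotheses place \<open>p\<close> in \<open>(a, b)\<close> and in \<open>(c, d)\<close>, because a monomial times \<open>c\<close> lies in
  \<open>(a, b)\<close> only if the monomial does.  For ideals generated by disjoint sets of variables the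
  intersection is the product.
\<close>

lemma mem_product_of_var_ideals:
  fixes p :: "('v, 'k::comm_ring_1) mpoly"
  assumes "distinct [a, b, c, d]"
  assumes ab: "var a * f + var b * g = var c * p" and cd: "var c * f' + var d * g' = var a * p"
  shows "\<exists>h1 h2 h3 h4. p = var a * var c * h1 + var a * var d * h2 +
    var b * var c * h3 + var b * var d * h4"
proof -
  let ?s = "\<lambda>v. Poly_Mapping.single v (Suc 0)"
  have 1: "Poly_Mapping.lookup p t = 0"
    if "Poly_Mapping.lookup t a = 0" "Poly_Mapping.lookup t b = 0" for t
  proof -
    have "Poly_Mapping.lookup p t = Poly_Mapping.lookup (var c * p) (t + ?s c)"
      by (simp add: lookup_var_mult lookup_add)
    also have "\<dots> = 0"
      unfolding ab [symmetric] using that assms(1)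
      by (auto simp: lookup_var_mult lookup_add lookup_single when_def)
    finally show ?thesis .
  qed
  have 2: "Poly_Mapping.lookup p t = 0"
    if "Poly_Mapping.lookup t c = 0" "Poly_Mapping.lookup t d = 0" for t
  proof -
    have "Poly_Mapping.lookup p t = Poly_Mapping.lookup (var a * p) (t + ?s a)"
      by (simp add: lookup_var_mult lookup_add)
    also have "\<dots> = 0"
      unfolding cd [symmetric] using that assms(1)
      by (auto simp: lookup_var_mult lookup_add lookup_single when_def)
    finally show ?thesis .
  qed
  have le: "(\<forall>w. Poly_Mapping.lookup (?s u + ?s v) w \<le> Poly_Mapping.lookup t w) \<longleftrightarrow>
      Poly_Mapping.lookup t u \<noteq> 0 \<and> Poly_Mapping.lookup t v \<noteq> 0" if "u \<noteq> v" for u v t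
    using that by (auto simp: lookup_add lookup_single when_def)
  have "p \<in> ideal_gen (monomial ` {?s a + ?s c, ?s a + ?s d, ?s b + ?s c, ?s b + ?s d})"
    unfolding mem_monomial_ideal_iff using 1 2 assms(1) by (auto simp: le in_keys_iff)
  then obtain h1 h2 h3 h4 where
    "p - h1 * monomial (?s a + ?s c) - h2 * monomial (?s a + ?s d)
      - h3 * monomial (?s b + ?s c) - h4 * monomial (?s b + ?s d) = 0"
    unfolding image_insert image_empty ideal_gen_insert ideal_gen_empty by blast
  then have "p = monomial (?s a + ?s c) * h1 + monomial (?s a + ?s d) * h2
      + monomial (?s b + ?s c) * h3 + monomial (?s b + ?s d) * h4"
    by (simp add: algebra_simps)
  moreover have mon: "monomial (?s u + ?s v) = (var u * var v :: ('v, 'k) mpoly)" for u v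
    by (simp add: var_def monomial_def mult_single)
  ultimately have "p = var a * var c * h1 + var a * var d * h2 +
    var b * var c * h3 + var b * var d * h4"
    by (simp only: mon)
  then show ?thesis by blast
qed

lemma mdeg_superset:
  assumes "finite A" "Poly_Mapping.keys t \<subseteq> A"
  shows "mdeg t = (\<Sum>v\<in>A. Poly_Mapping.lookup t v)"
  unfolding mdeg_def using assms by (intro sum.mono_neutral_left) (auto simp: in_keys_iff)

lemma mdeg_plus: "mdeg (s + t) = mdeg s + mdeg t"
proof -
  let ?A = "Poly_Mapping.keys s \<union> Poly_Mapping.keys t"
  have "finite ?A" "Poly_Mapping.keys (s + t) \<subseteq> ?A"
    using Poly_Mapping.keys_add [of s t] by auto
  then show ?thesis
    by (simp add: mdeg_superset [where A = ?A] lookup_add sum.distrib)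
qed

lemma mdeg_eq_0_iff: "mdeg t = 0 \<longleftrightarrow> t = 0"
  by (auto simp: mdeg_def in_keys_iff intro!: poly_mapping_eqI)

lemma mdeg_0 [simp]: "mdeg 0 = 0"
  by (simp add: mdeg_eq_0_iff)

lemma mdeg_single [simp]: "mdeg (Poly_Mapping.single v n) = n"
  by (simp add: mdeg_def)

lift_definition homogeneous_part :: "int \<Rightarrow> ('v, 'k::zero) mpoly \<Rightarrow> ('v, 'k) mpoly"
  is "\<lambda>k f t. if int (mdeg t) = k then f t else 0"
  by (rule finite_subset [rotated]) auto

lemma lookup_homogeneous_part:
  "Poly_Mapping.lookup (homogeneous_part k p) t =
    (if int (mdeg t) = k then Poly_Mapping.lookup p t else 0)"
  by transfer simp

lemma homogeneous_part_0 [simp]: "homogeneous_part k 0 = 0"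
  by (rule poly_mapping_eqI) (simp add: lookup_homogeneous_part)

lemma homogeneous_part_plus:
  "homogeneous_part k (p + q) = homogeneous_part k p + homogeneous_part k (q :: ('v, 'k::comm_ring_1) mpoly)"
  by (rule poly_mapping_eqI) (simp add: lookup_homogeneous_part lookup_add)

lemma homogeneous_part_of_homogeneous:
  assumes "\<And>t. t \<in> Poly_Mapping.keys p \<Longrightarrow> int (mdeg t) = n"
  shows "homogeneous_part k p = (if k = n then p else 0)"
  using assms by (intro poly_mapping_eqI) (auto simp: lookup_homogeneous_part in_keys_iff)

lemma homogeneous_part_mult:
  fixes p q :: "('v, 'k::comm_ring_1) mpoly"
  assumes q: "\<And>t. t \<in> Poly_Mapping.keys q \<Longrightarrow> int (mdeg t) = n"
  shows "homogeneous_part k (p * q) = homogeneous_part (k - n) p * q"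
proof (induction p rule: poly_induct)
  case zero
  show ?case by simp
next
  case (single_plus t c p)
  have "int (mdeg s) = int (mdeg t) + n" if s: "s \<in> Poly_Mapping.keys (Poly_Mapping.single t c * q)" for s
  proof -
    obtain u where "s = t + u" "u \<in> Poly_Mapping.keys q"
      using keys_mult [of "Poly_Mapping.single t c" q] s by (auto split: if_splits)
    then show ?thesis using q by (simp add: mdeg_plus)
  qed
  then have A: "homogeneous_part k (Poly_Mapping.single t c * q) =
      (if k = int (mdeg t) + n then Poly_Mapping.single t c * q else 0)"
    by (rule homogeneous_part_of_homogeneous)
  have B: "homogeneous_part (k - n) (Poly_Mapping.single t c) =
      (if k - n = int (mdeg t) then Poly_Mapping.single t c else 0)"
    by (rule homogeneous_part_of_homogeneous) (auto split: if_splits)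
  have "homogeneous_part k (Poly_Mapping.single t c * q) =
      homogeneous_part (k - n) (Poly_Mapping.single t c) * q"
    unfolding A B by auto
  then show ?case
    unfolding distrib_right homogeneous_part_plus single_plus.IH by (rule arg_cong [where f = "\<lambda>r. r + homogeneous_part (k - n) p * q"])
qed

section \<open>Homogeneous components and the graded Nakayama lemma\<close>

context graded_free_module
begin

abbreviation rep :: "'m \<Rightarrow> 'm \<Rightarrow> ('v, 'k) mpoly" where
  "rep \<equiv> representation B"

lemma rep_add: "rep (x + y) b = rep x b + rep y b"
  by (simp add: representation_add independent_basis span_basis)

lemma rep_diff: "rep (x - y) b = rep x b - rep y b"
  by (simp add: representation_diff independent_basis span_basis)

lemma rep_scale: "rep (scale p x) b = p * rep x b"
  by (simp add: representation_scale independent_basis span_basis)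

lemma rep_zero: "rep 0 b = 0"
  by (simp add: representation_zero)

lemma rep_sum: "rep (sum f A) b = (\<Sum>a\<in>A. rep (f a) b)"
  by (simp add: representation_sum independent_basis span_basis)

lemma rep_basis: "c \<in> B \<Longrightarrow> rep c b = (if b = c then 1 else 0)"
  by (simp add: representation_basis independent_basis)

lemma rep_notin: "b \<notin> B \<Longrightarrow> rep x b = 0"
  using representation_ne_zero by blast

lemma sum_rep: "(\<Sum>b | rep x b \<noteq> 0. scale (rep x b) b) = x"
  by (rule sum_nonzero_representation_eq) (simp_all add: independent_basis span_basis)

lemma eq_by_rep:
  assumes "\<And>b. b \<in> B \<Longrightarrow> rep x b = rep y b"
  shows "x = y"
proof -
  have "rep x = rep y"
  proof
    show "rep x b = rep y b" for b
      using assms [of b] by (cases "b \<in> B") (simp_all add: rep_notin)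
  qed
  then show ?thesis using sum_rep [of x] sum_rep [of y] by metis
qed

lemma mem_comp_iff: "x \<in> comp i \<longleftrightarrow> (\<forall>b. rep x b \<noteq> 0 \<longrightarrow> hdeg b = i)"
proof
  assume "x \<in> comp i"
  then have "rep x = representation {b \<in> B. hdeg b = i} x"
    unfolding comp_def by (intro representation_extend independent_basis) auto
  then show "\<forall>b. rep x b \<noteq> 0 \<longrightarrow> hdeg b = i"
    using representation_ne_zero by fastforce
next
  assume *: "\<forall>b. rep x b \<noteq> 0 \<longrightarrow> hdeg b = i"
  have "(\<Sum>b | rep x b \<noteq> 0. scale (rep x b) b) \<in> comp i"
    unfolding comp_def using * representation_ne_zero
    by (intro span_sum span_scale span_base) blast
  then show "x \<in> comp i" by (simp add: sum_rep)
qed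

lemma subspace_comp: "subspace (comp i)"
  by (simp add: comp_def)

lemmas comp_add = subspace_add [OF subspace_comp]
  and comp_diff = subspace_diff [OF subspace_comp]
  and comp_scale = subspace_scale [OF subspace_comp]

lemma basis_in_comp: "b \<in> B \<Longrightarrow> b \<in> comp (hdeg b)"
  by (simp add: comp_def span_base)

lemma homogD:
  "m \<in> homog n \<Longrightarrow> t \<in> Poly_Mapping.keys (rep m b) \<Longrightarrow> int (mdeg t) + tdeg b = n"
  using rep_notin by (cases "b \<in> B") (auto simp: homog_def)

lemma basis_in_homog: "b \<in> B \<Longrightarrow> b \<in> homog (tdeg b)"
  by (auto simp: homog_def rep_basis split: if_splits)

lemma homog_scale:
  assumes p: "\<And>t. t \<in> Poly_Mapping.keys p \<Longrightarrow> int (mdeg t) = k" and m: "m \<in> homog n"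
  shows "scale p m \<in> homog (k + n)"
  unfolding homog_def mem_Collect_eq
proof (intro ballI)
  fix b t assume "b \<in> B" "t \<in> Poly_Mapping.keys (rep (scale p m) b)"
  then obtain u s where "t = u + s" "u \<in> Poly_Mapping.keys p" "s \<in> Poly_Mapping.keys (rep m b)"
    using keys_mult [of p "rep m b"] by (auto simp: rep_scale)
  then show "int (mdeg t) + tdeg b = k + n"
    using p [of u] homogD [OF m, of s b] by (simp add: mdeg_plus)
qed

lemma homog_add: "x \<in> homog n \<Longrightarrow> y \<in> homog n \<Longrightarrow> x + y \<in> homog n"
  using Poly_Mapping.keys_add [of "rep x b" "rep y b" for b]
  unfolding homog_def mem_Collect_eq rep_add by fast

lemma homog_diff: "x \<in> homog n \<Longrightarrow> y \<in> homog n \<Longrightarrow> x - y \<in> homog n"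
  using keys_diff [of "rep x b" "rep y b" for b]
  unfolding homog_def mem_Collect_eq rep_diff by fast

lemma homog_var: "m \<in> homog n \<Longrightarrow> scale (var v) m \<in> homog (1 + n)"
  by (rule homog_scale) (auto simp: var_def monomial_def split: if_splits)

text \<open>
  Degree bookkeeping in coordinates: at a basis element of degree \<open>k\<close> the coordinate of an element of
  degree \<open>n\<close> is homogeneous of degree \<open>n - k\<close>.  So it is a constant if \<open>k = n\<close>, it vanishes if
  \<open>k > n\<close>, and it has no constant term if \<open>k \<noteq> n\<close>.
\<close>

lemma rep_of_degree:
  assumes "m \<in> homog n" and "tdeg b = n"
  shows "rep m b = Poly_Mapping.single 0 (Poly_Mapping.lookup (rep m b) 0)"
proof (rule poly_mapping_eqI)
  fix t
  have "t = 0" if "Poly_Mapping.lookup (rep m b) t \<noteq> 0"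
    using homogD [OF assms(1), of t b] that assms(2) mdeg_eq_0_iff [of t] by (simp add: in_keys_iff)
  then show "Poly_Mapping.lookup (rep m b) t =
      Poly_Mapping.lookup (Poly_Mapping.single 0 (Poly_Mapping.lookup (rep m b) 0)) t"
    by (auto simp: lookup_single when_def)
qed

lemma rep_above_degree:
  assumes "m \<in> homog n" and "n < tdeg b"
  shows "rep m b = 0"
proof (rule poly_mapping_eqI)
  fix t show "Poly_Mapping.lookup (rep m b) t = Poly_Mapping.lookup 0 t"
    using homogD [OF assms(1), of t b] assms(2) by (auto simp: in_keys_iff)
qed

lemma no_constant_off_degree:
  assumes "m \<in> homog n" and "tdeg b \<noteq> n"
  shows "Poly_Mapping.lookup (rep m b) 0 = 0"
  using homogD [OF assms(1), of 0 b] assms(2) by (auto simp: in_keys_iff)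

definition homog_component :: "int \<Rightarrow> 'm \<Rightarrow> 'm" where
  "homog_component n m =
     (\<Sum>b | rep m b \<noteq> 0. scale (homogeneous_part (n - tdeg b) (rep m b)) b)"

lemma rep_homog_component:
  "rep (homog_component n m) b = homogeneous_part (n - tdeg b) (rep m b)"
proof -
  have fin: "finite {c. rep m c \<noteq> 0}" by (rule finite_representation)
  have "rep (homog_component n m) b =
      (\<Sum>c | rep m c \<noteq> 0. homogeneous_part (n - tdeg c) (rep m c) * rep c b)"
    unfolding homog_component_def rep_sum rep_scale ..
  also have "\<dots> = (\<Sum>c | rep m c \<noteq> 0. if b = c then homogeneous_part (n - tdeg b) (rep m b) else 0)"
    using representation_ne_zero by (intro sum.cong) (auto simp: rep_basis)
  also have "\<dots> = homogeneous_part (n - tdeg b) (rep m b)"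
    using fin by simp
  finally show ?thesis .
qed

lemma homog_component_in_homog: "homog_component n m \<in> homog n"
  by (auto simp: homog_def rep_homog_component in_keys_iff lookup_homogeneous_part split: if_splits)

lemma homog_component_in_comp: "m \<in> comp i \<Longrightarrow> homog_component n m \<in> comp i"
  unfolding mem_comp_iff rep_homog_component by (metis homogeneous_part_0)

lemma homog_component_0: "homog_component n 0 = 0"
  by (rule eq_by_rep) (simp add: rep_homog_component rep_zero)

lemma homog_component_add:
  "homog_component n (x + y) = homog_component n x + homog_component n y"
  by (rule eq_by_rep) (simp add: rep_homog_component rep_add homogeneous_part_plus)

lemma homog_component_scale:
  assumes "m \<in> homog k"
  shows "homog_component n (scale p m) = scale (homogeneous_part (n - k) p) m"
proof (rule eq_by_rep)
  fix b
  have "homogeneous_part (n - tdeg b) (p * rep m b) =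
      homogeneous_part (n - tdeg b - (k - tdeg b)) p * rep m b"
    using homogD [OF assms] by (intro homogeneous_part_mult) (auto simp: algebra_simps)
  then show "rep (homog_component n (scale p m)) b = rep (scale (homogeneous_part (n - k) p) m) b"
    by (simp add: rep_homog_component rep_scale)
qed

lemma homog_component_of_homog:
  assumes "m \<in> homog k"
  shows "homog_component n m = (if n = k then m else 0)"
proof -
  have "homogeneous_part (n - k) (1 :: ('v, 'k) mpoly) = (if n - k = 0 then 1 else 0)"
    by (rule homogeneous_part_of_homogeneous) (simp split: if_splits)
  then show ?thesis using homog_component_scale [OF assms, of n 1] by simp
qed

lemma homog_component_in_span:
  assumes "\<And>g. g \<in> G \<Longrightarrow> \<exists>k. g \<in> homog k" and "m \<in> span G"
  shows "homog_component n m \<in> span G"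
  using assms(2)
proof (induction rule: span_induct_alt)
  case base
  show ?case by (simp add: homog_component_0 span_zero)
next
  case (step c x y)
  then obtain k where "x \<in> homog k" using assms(1) by blast
  then show ?case
    using step by (simp add: homog_component_add homog_component_scale span_add span_scale span_base)
qed

text \<open>
  Generators of degree above \<open>n\<close> contribute nothing to the component of degree \<open>n\<close>.
\<close>

lemma homog_component_in_span_low:
  assumes "\<And>g. g \<in> G \<Longrightarrow> g \<in> H \<or> (\<exists>k>n. g \<in> homog k)" and H: "\<And>g. g \<in> H \<Longrightarrow> \<exists>k. g \<in> homog k"
    and "m \<in> span G"
  shows "homog_component n m \<in> span H"
  using assms(3)
proof (induction rule: span_induct_alt)
  case base
  show ?case by (simp add: homog_component_0 span_zero)
next
  case (step c x y)
  have "homog_component n (scale c x) \<in> span H"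
  proof (cases "x \<in> H")
    case True
    then show ?thesis using H homog_component_in_span [of H "scale c x" n]
      by (simp add: span_scale span_base)
  next
    case False
    then obtain k where k: "x \<in> homog k" "k > n" using assms(1) step by blast
    have "homogeneous_part (n - k) c = 0"
      using k(2) by (intro poly_mapping_eqI) (auto simp: lookup_homogeneous_part)
    then show ?thesis using k(1) by (simp add: homog_component_scale span_zero)
  qed
  then show ?case using step by (simp add: homog_component_add span_add)
qed

text \<open>
  The hypothesis on \<open>G\<close> says that \<open>G\<close> generates the component modulo the ideal of the variables.  A basis
  element \<open>b\<close> is then a combination of \<open>G\<close> plus a remainder whose coordinates have no constant term.
  In the degree of \<open>b\<close> such a remainder involves only basis elements of smaller degree, so induction on
  the degree puts it into the span of \<open>G\<close>.
\<close>

lemma graded_Nakayama: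
  assumes hom: "\<And>g. g \<in> G \<Longrightarrow> \<exists>k. g \<in> homog k" and "G \<subseteq> comp i"
    and gen: "\<And>m. m \<in> comp i \<Longrightarrow>
      \<exists>n\<in>span G. \<forall>b. Poly_Mapping.lookup (rep (m - n) b) 0 = 0"
  shows "comp i = span G"
proof -
  have G: "span G \<subseteq> comp i"
    using assms(2) subspace_comp by (rule span_minimal)
  let ?Bi = "{b \<in> B. hdeg b = i}"
  \<comment> \<open>Degrees are integers, so the induction needs a lower bound; there is one because the component
    has a finite basis.\<close>
  have lower: "\<exists>l. \<forall>b\<in>?Bi. l \<le> tdeg b"
  proof (intro exI ballI)
    show "Min (tdeg ` ?Bi) \<le> tdeg b" if "b \<in> ?Bi" for b
      using that finite_basis by auto
  qed
  then obtain l where l: "\<And>b. b \<in> ?Bi \<Longrightarrow> l \<le> tdeg b" by blast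
  have "b \<in> span G" if "b \<in> ?Bi" for b
    using that
  proof (induction "nat (tdeg b - l)" arbitrary: b rule: less_induct)
    case less
    let ?c = "homog_component (tdeg b)"
    have b: "b \<in> comp i" using less.prems basis_in_comp by auto
    then obtain n where n: "n \<in> span G" "\<And>c. Poly_Mapping.lookup (rep (b - n) c) 0 = 0"
      using gen by blast
    have r: "?c (b - n) \<in> comp i"
      using b n(1) G by (intro homog_component_in_comp comp_diff) auto
    have "scale (rep (?c (b - n)) c) c \<in> span G" if c: "rep (?c (b - n)) c \<noteq> 0" for c
    proof -
      obtain t where t: "Poly_Mapping.lookup (rep (?c (b - n)) c) t \<noteq> 0"
        using c by (metis poly_mapping_eqI lookup_zero)
      then have "int (mdeg t) = tdeg b - tdeg c" "t \<noteq> 0"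
        using n(2) by (auto simp: rep_homog_component lookup_homogeneous_part split: if_splits)
      then have "tdeg c < tdeg b" using mdeg_eq_0_iff [of t] by linarith
      moreover have "c \<in> ?Bi" using c r rep_notin by (auto simp: mem_comp_iff)
      ultimately have "c \<in> span G" using less.hyps [of c] l [of c] by auto
      then show ?thesis by (rule span_scale)
    qed
    then have "(\<Sum>c | rep (?c (b - n)) c \<noteq> 0. scale (rep (?c (b - n)) c) c) \<in> span G"
      by (intro span_sum) simp
    then have "?c (b - n) \<in> span G" by (simp only: sum_rep)
    moreover have "?c n \<in> span G" using hom n(1) by (rule homog_component_in_span)
    ultimately have "?c (b - n + n) \<in> span G" unfolding homog_component_add by (rule span_add)
    moreover have "?c b = b"
      using less.prems by (simp add: homog_component_of_homog [OF basis_in_homog])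
    ultimately show ?case by simp
  qed
  then have "comp i \<subseteq> span G" unfolding comp_def by (intro span_minimal) auto
  with G show ?thesis by blast
qed

lemma tdeg_basis_bound:
  assumes "comp i = span G" and "\<And>g. g \<in> G \<Longrightarrow> \<exists>k\<ge>n. g \<in> homog k" and b: "b \<in> B" "hdeg b = i"
  shows "n \<le> tdeg b"
proof (rule ccontr)
  assume "\<not> n \<le> tdeg b"
  then have "homog_component (tdeg b) b \<in> span {}"
    using assms basis_in_comp [of b] by (intro homog_component_in_span_low [of G]) force+
  then have "b = 0" using b by (simp add: homog_component_of_homog [OF basis_in_homog])
  then show False using rep_basis [OF b(1), of b] by (simp add: rep_zero)
qed

lemma rep_constant:
  assumes "m \<in> comp i" "m \<in> homog n" and "\<And>b. b \<in> B \<Longrightarrow> hdeg b = i \<Longrightarrow> n \<le> tdeg b"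
    and "t \<noteq> 0"
  shows "Poly_Mapping.lookup (rep m b) t = 0"
proof (rule ccontr)
  assume *: "Poly_Mapping.lookup (rep m b) t \<noteq> 0"
  then have "int (mdeg t) + tdeg b = n"
    using homogD [OF assms(2)] by (simp add: in_keys_iff)
  moreover have "n \<le> tdeg b"
    using * assms(1,3) rep_notin by (metis lookup_zero mem_comp_iff)
  ultimately have "mdeg t = 0" by linarith
  with \<open>t \<noteq> 0\<close> show False by (simp add: mdeg_eq_0_iff)
qed

text \<open>
  If \<open>n\<close> is a lower bound for the degrees of the basis, then elements of degree \<open>n\<close> have constant
  coordinates.  Thus the single coefficient at the monomial \<open>1\<close> decides whether such an element vanishes.
\<close>

lemma eq_0_by_constant_coefficients:
  assumes "m \<in> comp i" "m \<in> homog n" and "\<And>b. b \<in> B \<Longrightarrow> hdeg b = i \<Longrightarrow> n \<le> tdeg b"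
    and "\<And>b. Poly_Mapping.lookup (rep m b) 0 = 0"
  shows "m = 0"
proof (rule eq_by_rep)
  fix b
  have "Poly_Mapping.lookup (rep m b) t = 0" for t
    using rep_constant [OF assms(1-3), where t=t and b=b] assms(4) by (cases "t = 0") auto
  then show "rep m b = rep 0 b" by (intro poly_mapping_eqI) (simp add: rep_zero)
qed

lemma eq_0_below_tdeg:
  assumes "m \<in> comp i" "m \<in> homog n" and "\<And>b. b \<in> B \<Longrightarrow> hdeg b = i \<Longrightarrow> n < tdeg b"
  shows "m = 0"
proof (rule eq_0_by_constant_coefficients [OF assms(1,2)])
  show "n \<le> tdeg b" if "b \<in> B" "hdeg b = i" for b using assms(3) [OF that] by simp
  show "Poly_Mapping.lookup (rep m b) 0 = 0" for b
  proof (rule ccontr)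
    assume *: "Poly_Mapping.lookup (rep m b) 0 \<noteq> 0"
    then have "tdeg b = n" using homogD [OF assms(2), of 0 b] by (simp add: in_keys_iff)
    moreover have "n < tdeg b"
      using * assms(1,3) rep_notin by (metis lookup_zero mem_comp_iff)
    ultimately show False by simp
  qed
qed

end

section \<open>Minimal graded resolutions\<close>

context minimal_graded_free_resolution
begin

sublocale d: module_hom scale scale d
  by (rule d_linear)

lemma rep_d_no_constant: "Poly_Mapping.lookup (rep (d m) b) 0 = 0"
proof -
  have "d m \<in> span {scale (var v) m | v m. True}" using minimal by blast
  then show ?thesis
  proof (induction rule: span_induct_alt)
    case base
    show ?case by (simp add: rep_zero)
  next
    case (step c x y)
    from step(1) obtain v m where x: "x = scale (var v) m"
      unfolding mem_Collect_eq by (elim exE conjE)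
    have "rep (scale c x) b = var v * (c * rep m b)"
      unfolding x rep_scale by (rule mult.left_commute)
    then show ?case using step.IH by (simp add: rep_add lookup_add lookup_var_mult)
  qed
qed

text \<open>
  Both sides are additive, and a term times a basis element is homogeneous, so that its boundary is
  homogeneous of the same degree.
\<close>

lemma d_homog_component: "d (homog_component n m) = homog_component n (d m)"
proof -
  have on_multiples: "d (homog_component n (scale p b)) = homog_component n (d (scale p b))" if "b \<in> B" for p b
  proof (induction p rule: poly_induct)
    case zero
    show ?case by (simp add: homog_component_0)
  next
    case (single_plus t c p)
    let ?m = "scale (Poly_Mapping.single t c) b"
    have m: "?m \<in> homog (int (mdeg t) + tdeg b)"
      by (rule homog_scale [OF _ basis_in_homog [OF that]]) (auto split: if_splits)
    then have "d ?m \<in> homog (int (mdeg t) + tdeg b)" using d_homog by blast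
    then have "d (homog_component n ?m) = homog_component n (d ?m)"
      using m by (simp add: homog_component_of_homog)
    then show ?case using single_plus
      by (simp add: scale_left_distrib homog_component_add d.add)
  qed
  have "m \<in> span B" by (simp add: span_basis)
  then show ?thesis
    by (induction rule: span_induct_alt) (simp_all add: homog_component_0 homog_component_add d.add on_multiples)
qed

text \<open>
  Exactness provides preimages; taking a component makes them homogeneous.
\<close>

lemma homogeneous_preimage:
  assumes "d m \<in> homog n" "m \<in> comp i"
  shows "\<exists>m'. m' \<in> comp i \<and> m' \<in> homog n \<and> d m' = d m"
  using assms
  by (intro exI [of _ "homog_component n m"])
    (simp add: homog_component_in_comp homog_component_in_homog d_homog_component
      homog_component_of_homog)

lemma lift_cycle:
  assumes "m \<in> comp (Suc i)" "m \<in> homog n" "d m = 0"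
  shows "\<exists>m'. m' \<in> comp (Suc (Suc i)) \<and> m' \<in> homog n \<and> d m' = m"
proof -
  have "m \<in> d ` comp (Suc (Suc i))" using assms exact_Suc by blast
  then show ?thesis using homogeneous_preimage assms(2) by blast
qed

lemma d_in_comp: "m \<in> comp (Suc i) \<Longrightarrow> d m \<in> comp i"
  using d_comp by blast

lemma e_in_B: "e \<in> B"
  using basis_0 by auto

lemma e_in_homog: "e \<in> homog 0"
  using basis_in_homog [OF e_in_B] by (simp add: tdeg_e)

lemma scale_e_eq_iff: "scale p e = scale q e \<longleftrightarrow> p = q"
proof
  assume "scale p e = scale q e"
  then have "rep (scale p e) e = rep (scale q e) e" by simp
  then show "p = q" by (simp add: rep_scale rep_basis [OF e_in_B])
qed simp

lemma d_d: "m \<in> comp (Suc (Suc i)) \<Longrightarrow> d (d m) = 0"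
  using exact_Suc by blast

lemma d_comp_1: "m \<in> comp 1 \<Longrightarrow> \<exists>p\<in>I. d m = scale p e"
  using exact_0 by blast

text \<open>
  A basis element in the kernel would be a boundary by exactness, but by minimality the coordinates of a
  boundary have no constant term.
\<close>

lemma basis_not_cycle:
  assumes "b \<in> B" "hdeg b = Suc i"
  shows "d b \<noteq> 0"
proof
  assume "d b = 0"
  then have "b \<in> d ` comp (Suc (Suc i))"
    using exact_Suc basis_in_comp [OF assms(1)] assms(2) by auto
  then have "Poly_Mapping.lookup (rep b b) 0 = 0" using rep_d_no_constant by blast
  then show False using assms(1) by (simp add: rep_basis)
qed

end

section \<open>The ideal and the syzygies of its generators\<close>

abbreviation vx :: "(indet, 'k::comm_ring_1) mpoly" where "vx \<equiv> var Vx"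
abbreviation vy :: "(indet, 'k::comm_ring_1) mpoly" where "vy \<equiv> var Vy"
abbreviation vz :: "(indet, 'k::comm_ring_1) mpoly" where "vz \<equiv> var Vz"
abbreviation vw :: "(indet, 'k::comm_ring_1) mpoly" where "vw \<equiv> var Vw"

text \<open>
  The exponent vector of \<open>x\<^sup>a y\<^sup>b z\<^sup>c w\<^sup>f\<close>.
\<close>

definition expo :: "nat \<Rightarrow> nat \<Rightarrow> nat \<Rightarrow> nat \<Rightarrow> indet \<Rightarrow>\<^sub>0 nat" where
  "expo a b c f = Poly_Mapping.single Vx a + Poly_Mapping.single Vy b +
     Poly_Mapping.single Vz c + Poly_Mapping.single Vw f"

lemma lookup_expo [simp]:
  "Poly_Mapping.lookup (expo a b c f) Vx = a"
  "Poly_Mapping.lookup (expo a b c f) Vy = b"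
  "Poly_Mapping.lookup (expo a b c f) Vz = c"
  "Poly_Mapping.lookup (expo a b c f) Vw = f"
  by (simp_all add: expo_def lookup_add lookup_single)

lemma all_indet: "(\<forall>v. P v) \<longleftrightarrow> P Vx \<and> P Vy \<and> P Vz \<and> P Vw"
  by (metis indet.exhaust)

lemma ex_indet: "(\<exists>v. P v) \<longleftrightarrow> P Vx \<or> P Vy \<or> P Vz \<or> P Vw"
  by (metis indet.exhaust)

lemma expo_eq_iff: "expo a b c f = t \<longleftrightarrow>
    Poly_Mapping.lookup t Vx = a \<and> Poly_Mapping.lookup t Vy = b \<and>
    Poly_Mapping.lookup t Vz = c \<and> Poly_Mapping.lookup t Vw = f"
  by (auto simp: poly_mapping_eq_iff fun_eq_iff all_indet)

lemma mdeg_expo: "mdeg (expo a b c f) = a + b + c + f"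
  by (simp add: expo_def mdeg_plus)

lemma power2_var: "var v ^ 2 = (monomial (Poly_Mapping.single v 2) :: ('v, 'k::comm_ring_1) mpoly)"
  by (simp add: power2_eq_square var_def monomial_def mult_single numeral_2_eq_2 flip: single_add)

lemma monomial_mult: "monomial s * monomial t = (monomial (s + t) :: ('v, 'k::comm_ring_1) mpoly)"
  by (simp add: monomial_def mult_single)

lemma generators_as_monomials:
  "vx ^ 2 = monomial (expo 2 0 0 0)" "vx * vy = monomial (expo 1 1 0 0)"
  "vy ^ 2 * vz ^ 2 = monomial (expo 0 2 2 0)" "vz * vw = monomial (expo 0 0 1 1)"
  "vw ^ 2 = monomial (expo 0 0 0 2)"
  unfolding power2_var monomial_mult unfolding var_def monomial_mult
  by (simp_all add: expo_def)

definition gen_exponents :: "(indet \<Rightarrow>\<^sub>0 nat) set" where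
  "gen_exponents = {expo 2 0 0 0, expo 1 1 0 0, expo 0 2 2 0, expo 0 0 1 1, expo 0 0 0 2}"

definition example_ideal :: "(indet, 'k::comm_ring_1) mpoly set" where
  "example_ideal = ideal_gen {vx ^ 2, vx * vy, vy ^ 2 * vz ^ 2, vz * vw, vw ^ 2}"

lemma example_ideal_monomial: "example_ideal = ideal_gen (monomial ` gen_exponents)"
  by (simp add: example_ideal_def gen_exponents_def generators_as_monomials)

lemma gen_exponents_antichain:
  assumes "s \<in> gen_exponents" "t \<in> gen_exponents"
    and "\<forall>v. Poly_Mapping.lookup s v \<le> Poly_Mapping.lookup t v"
  shows "s = t"
  using assms by (auto simp: gen_exponents_def all_indet)

lemma example_ideal_strongly_generic:
  "strongly_generic (example_ideal :: (indet, 'k::comm_ring_1) mpoly set)"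
  unfolding strongly_generic_def
proof (intro exI conjI)
  show "minimal_monomial_generators (example_ideal :: (indet, 'k) mpoly set) gen_exponents"
    unfolding minimal_monomial_generators_def
  proof (intro conjI allI impI notI)
    show "ideal_gen (monomial ` gen_exponents) = (example_ideal :: (indet, 'k) mpoly set)"
      by (rule example_ideal_monomial [symmetric])
    fix H assume H: "H \<subset> gen_exponents"
      and eq: "ideal_gen (monomial ` H) = (example_ideal :: (indet, 'k) mpoly set)"
    from H obtain t where t: "t \<in> gen_exponents" "t \<notin> H" by blast
    have keys: "t \<in> Poly_Mapping.keys (monomial t :: (indet, 'k) mpoly)"
      by (simp add: monomial_def)
    have "(monomial t :: (indet, 'k) mpoly) \<in> ideal_gen (monomial ` H)"
      unfolding eq example_ideal_monomial mem_monomial_ideal_iff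
      using t(1) by (auto simp: monomial_def)
    then obtain s where "s \<in> H" "\<forall>v. Poly_Mapping.lookup s v \<le> Poly_Mapping.lookup t v"
      using keys unfolding mem_monomial_ideal_iff by blast
    then show False using gen_exponents_antichain [of s t] H t by blast
  qed
  show "\<forall>s\<in>gen_exponents. \<forall>t\<in>gen_exponents. s \<noteq> t \<longrightarrow>
      \<not> (\<exists>v. Poly_Mapping.lookup s v \<noteq> 0 \<and> Poly_Mapping.lookup s v = Poly_Mapping.lookup t v)"
    by (simp add: gen_exponents_def ex_indet)
qed

text \<open>
  The syzygies of the five monomials are generated by those of the eight pairs that are edges of the Scarf
  complex; the right sides are the coordinates of a combination of these pair syzygies.
  The coefficient \<open>q3\<close> of \<open>y\<^sup>2z\<^sup>2\<close> lies in \<open>(x, w)\<close>, so the pairs \<open>23\<close> and \<open>34\<close> can be used to remove it.  What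
  remains is \<open>x (q1 x + r2 y) = - w (r4 z + q5 w)\<close>.  So the first bracket is \<open>w h\<close> and the second is
  \<open>- x h\<close>, where \<open>h\<close> lies in \<open>(x, y) \<inter> (z, w)\<close>.  The four products of a variable from each pair account
  for the edges \<open>14, 15, 24, 25\<close>, and what is left are Koszul relations for the edges \<open>12\<close> and \<open>45\<close>.
\<close>

lemma example_syzygies:
  fixes q1 q2 q3 q4 q5 :: "(indet, 'k::comm_ring_1) mpoly"
  assumes "q1 * vx ^ 2 + q2 * (vx * vy) + q3 * (vy ^ 2 * vz ^ 2) + q4 * (vz * vw) + q5 * vw ^ 2 = 0"
  shows "\<exists>p12 p23 p34 p45 p14 p15 p24 p25.
    q1 = - (vy * p12 + vz * vw * p14 + vw ^ 2 * p15) \<and>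
    q2 = vx * p12 - vy * vz ^ 2 * p23 - vz * vw * p24 - vw ^ 2 * p25 \<and>
    q3 = vx * p23 - vw * p34 \<and>
    q4 = vy ^ 2 * vz * p34 - vw * p45 + vx ^ 2 * p14 + vx * vy * p24 \<and>
    q5 = vz * p45 + vx ^ 2 * p15 + vx * vy * p25"
proof -
  have q3_eq: "q3 * (vy ^ 2 * vz ^ 2) = vx * (- q1 * vx - q2 * vy) + vw * (- q4 * vz - q5 * vw)"
  proof -
    have "q3 * (vy ^ 2 * vz ^ 2) - (vx * (- q1 * vx - q2 * vy) + vw * (- q4 * vz - q5 * vw)) =
        q1 * vx ^ 2 + q2 * (vx * vy) + q3 * (vy ^ 2 * vz ^ 2) + q4 * (vz * vw) + q5 * vw ^ 2"
      by (simp add: algebra_simps power2_eq_square)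
    then show ?thesis unfolding assms by (simp only: right_minus_eq)
  qed
  have "Poly_Mapping.lookup q3 t = 0"
    if t: "Poly_Mapping.lookup t Vx = 0" "Poly_Mapping.lookup t Vw = 0" for t
  proof -
    let ?t = "t + expo 0 2 2 0"
    have "Poly_Mapping.lookup (vy * (vy * (vz * (vz * q3)))) ?t = Poly_Mapping.lookup q3 t"
      by (simp add: lookup_var_mult lookup_add lookup_minus lookup_single)
        (rule arg_cong [where f = "Poly_Mapping.lookup q3"],
          simp add: poly_mapping_eq_iff fun_eq_iff all_indet lookup_add lookup_minus lookup_single)
    moreover have "vy * (vy * (vz * (vz * q3))) = q3 * (vy ^ 2 * vz ^ 2)"
      by (simp add: power2_eq_square algebra_simps)
    ultimately show ?thesis
      unfolding q3_eq using t by (simp add: lookup_add lookup_var_mult)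
  qed
  then obtain p23 p34' where q3: "q3 = vx * p23 + vw * p34'"
    using mem_var_ideal [of Vx Vw q3] by blast
  define p34 where "p34 = - p34'"
  define r2 where "r2 = q2 + vy * vz ^ 2 * p23"
  define r4 where "r4 = q4 - vy ^ 2 * vz * p34"
  have r: "vx * (q1 * vx + r2 * vy) = vw * (- (r4 * vz + q5 * vw))"
  proof -
    have "vx * (q1 * vx + r2 * vy) - vw * (- (r4 * vz + q5 * vw)) =
        q1 * vx ^ 2 + q2 * (vx * vy) + q3 * (vy ^ 2 * vz ^ 2) + q4 * (vz * vw) + q5 * vw ^ 2"
      unfolding q3 r2_def r4_def p34_def by (simp add: algebra_simps power2_eq_square)
    then show ?thesis unfolding assms by (simp only: right_minus_eq)
  qed
  obtain h where h: "q1 * vx + r2 * vy = vw * h" "- (r4 * vz + q5 * vw) = vx * h"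
    using var_syzygy [OF _ r] by auto
  have "vx * q1 + vy * r2 = vw * h" "vw * (- q5) + vz * (- r4) = vx * h"
    using h by (simp_all add: algebra_simps)
  then obtain h1 h2 h3 h4 where h_eq: "h = vx * vw * h1 + vx * vz * h2 + vy * vw * h3 + vy * vz * h4"
    using mem_product_of_var_ideals [of Vx Vy Vw Vz q1 r2 h "- q5" "- r4"] by auto
  have "vx * (q1 - vw * (vw * h1 + vz * h2)) = vy * (vw * (vw * h3 + vz * h4) - r2)"
    using h(1) unfolding h_eq by (simp add: algebra_simps)
  then obtain k where k: "q1 - vw * (vw * h1 + vz * h2) = vy * k" "vw * (vw * h3 + vz * h4) - r2 = vx * k"
    using var_syzygy [of Vx Vy] by blast
  have "vz * (- (r4 + vx * (vx * h2 + vy * h4))) = vw * (q5 + vx * (vx * h1 + vy * h3))"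
  proof -
    have "vz * (- (r4 + vx * (vx * h2 + vy * h4))) - vw * (q5 + vx * (vx * h1 + vy * h3)) =
        - (r4 * vz + q5 * vw) - vx * h"
      unfolding h_eq by (simp add: algebra_simps)
    then show ?thesis unfolding h(2) by (simp only: right_minus_eq diff_self)
  qed
  then obtain l where l: "- (r4 + vx * (vx * h2 + vy * h4)) = vw * l"
      "q5 + vx * (vx * h1 + vy * h3) = vz * l"
    using var_syzygy [of Vz Vw] by blast
  show ?thesis
  proof (intro exI conjI)
    show "q1 = - (vy * (- k) + vz * vw * (- h2) + vw ^ 2 * (- h1))"
      using k(1) by (simp add: algebra_simps power2_eq_square)
    show "q2 = vx * (- k) - vy * vz ^ 2 * p23 - vz * vw * (- h4) - vw ^ 2 * (- h3)"
      using k(2) unfolding r2_def by (simp add: algebra_simps power2_eq_square)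
    show "q3 = vx * p23 - vw * p34"
      unfolding q3 p34_def by simp
    show "q4 = vy ^ 2 * vz * p34 - vw * l + vx ^ 2 * (- h2) + vx * vy * (- h4)"
      using l(1) unfolding r4_def by (simp add: algebra_simps power2_eq_square)
    show "q5 = vz * l + vx ^ 2 * (- h1) + vx * vy * (- h3)"
      using l(2) by (simp add: algebra_simps power2_eq_square)
  qed
qed

section \<open>The beginning of the resolution\<close>

locale example_resolution = minimal_graded_free_resolution scale B hdeg tdeg e d example_ideal
  for scale :: "(indet, 'k::field) mpoly \<Rightarrow> 'm::ab_group_add \<Rightarrow> 'm" (infixr "\<cdot>" 75)
    and B hdeg tdeg e d

context example_resolution
begin

text \<open>
  An element of \<open>F\<^sub>1\<close> whose coordinates have no constant term is mapped into the product of the maximal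
  ideal and \<open>example_ideal\<close>.  The five generators do not occur as terms of elements of that product,
  because none of them is a proper multiple of another.
\<close>

lemma d_generator_coefficient:
  assumes m: "m \<in> comp 1" "\<And>b. Poly_Mapping.lookup (rep m b) 0 = 0" and p: "d m = p \<cdot> e"
    and s: "s \<in> gen_exponents"
  shows "Poly_Mapping.lookup p s = 0"
proof -
  have "\<exists>q. q \<in> example_ideal \<and> d b = q \<cdot> e" if "rep m b \<noteq> 0" for b
  proof -
    have "b \<in> comp 1"
      using that m(1) basis_in_comp [of b] rep_notin [of b m] by (auto simp: mem_comp_iff)
    then show ?thesis using d_comp_1 by blast
  qed
  then obtain q where q: "\<And>b. rep m b \<noteq> 0 \<Longrightarrow> q b \<in> example_ideal"
      "\<And>b. rep m b \<noteq> 0 \<Longrightarrow> d b = q b \<cdot> e"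
    by metis
  have "d m = d (\<Sum>b | rep m b \<noteq> 0. rep m b \<cdot> b)"
    by (simp only: sum_rep)
  also have "\<dots> = (\<Sum>b | rep m b \<noteq> 0. rep m b * q b) \<cdot> e"
    by (simp add: d.sum d.scale scale_sum_left q(2))
  finally have "p = (\<Sum>b | rep m b \<noteq> 0. rep m b * q b)"
    unfolding p scale_e_eq_iff .
  moreover have "Poly_Mapping.lookup (rep m b * q b) s = 0" if b: "rep m b \<noteq> 0" for b
  proof (rule ccontr)
    assume "Poly_Mapping.lookup (rep m b * q b) s \<noteq> 0"
    then have "s \<in> Poly_Mapping.keys (rep m b * q b)" by (simp add: in_keys_iff)
    then obtain u v where uv: "s = u + v" "u \<in> Poly_Mapping.keys (rep m b)" "v \<in> Poly_Mapping.keys (q b)"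
      using keys_mult [of "rep m b" "q b"] by blast
    obtain g where g: "g \<in> gen_exponents" "\<forall>i. Poly_Mapping.lookup g i \<le> Poly_Mapping.lookup v i"
      using q(1) [OF b] uv(3) unfolding example_ideal_monomial mem_monomial_ideal_iff by blast
    have "\<forall>i. Poly_Mapping.lookup g i \<le> Poly_Mapping.lookup s i"
      using g(2) by (simp add: uv(1) lookup_add trans_le_add2)
    then have "g = s" using g(1) s gen_exponents_antichain by blast
    have "Poly_Mapping.lookup u i = 0" for i
      using g(2) [rule_format, of i] unfolding \<open>g = s\<close> uv(1) lookup_add by simp
    then have "u = 0" by (intro poly_mapping_eqI) simp
    then show False using uv(2) m(2) by (simp add: in_keys_iff)
  qed
  ultimately show ?thesis by (simp add: lookup_sum)
qed

end

text \<open>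
  Homogeneous lifts of the vertices and edges of the Scarf complex.  Besides the pairs of
  neighbours \<open>12, 23, 34, 45\<close> its edges are the pairs that combine one of \<open>1, 2\<close> with one of \<open>4, 5\<close>.
  The degree of each lift is the degree of the least common multiple of its vertices.
\<close>

locale scarf_lift = example_resolution scale B hdeg tdeg e d
  for scale :: "(indet, 'k::field) mpoly \<Rightarrow> 'm::ab_group_add \<Rightarrow> 'm" (infixr "\<cdot>" 75)
    and B hdeg tdeg e d +
  fixes a1 a2 a3 a4 a5 a12 a23 a34 a45 a14 a15 a24 a25 :: 'm
  assumes comp_1: "a1 \<in> comp 1" "a2 \<in> comp 1" "a3 \<in> comp 1" "a4 \<in> comp 1" "a5 \<in> comp 1"
    and homog_1: "a1 \<in> homog 2" "a2 \<in> homog 2" "a3 \<in> homog 4" "a4 \<in> homog 2" "a5 \<in> homog 2"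
    and d_1: "d a1 = vx ^ 2 \<cdot> e" "d a2 = (vx * vy) \<cdot> e" "d a3 = (vy ^ 2 * vz ^ 2) \<cdot> e"
      "d a4 = (vz * vw) \<cdot> e" "d a5 = vw ^ 2 \<cdot> e"
    and comp_2: "a12 \<in> comp 2" "a23 \<in> comp 2" "a34 \<in> comp 2" "a45 \<in> comp 2"
      "a14 \<in> comp 2" "a15 \<in> comp 2" "a24 \<in> comp 2" "a25 \<in> comp 2"
    and homog_2: "a12 \<in> homog 3" "a23 \<in> homog 5" "a34 \<in> homog 5" "a45 \<in> homog 3"
      "a14 \<in> homog 4" "a15 \<in> homog 4" "a24 \<in> homog 4" "a25 \<in> homog 4"
    and d_2: "d a12 = vx \<cdot> a2 - vy \<cdot> a1" "d a23 = vx \<cdot> a3 - (vy * vz ^ 2) \<cdot> a2"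
      "d a34 = (vy ^ 2 * vz) \<cdot> a4 - vw \<cdot> a3" "d a45 = vz \<cdot> a5 - vw \<cdot> a4"
      "d a14 = vx ^ 2 \<cdot> a4 - (vz * vw) \<cdot> a1" "d a15 = vx ^ 2 \<cdot> a5 - vw ^ 2 \<cdot> a1"
      "d a24 = (vx * vy) \<cdot> a4 - (vz * vw) \<cdot> a2" "d a25 = (vx * vy) \<cdot> a5 - vw ^ 2 \<cdot> a2"

context example_resolution
begin

lemma homog_expo: "m \<in> homog n \<Longrightarrow> k = int (a + b + c + f) + n \<Longrightarrow> monomial (expo a b c f) \<cdot> m \<in> homog k"
  using homog_scale [of "monomial (expo a b c f)" "int (a + b + c + f)" m n]
  by (auto simp: monomial_def mdeg_expo)

lemma lift_generator:
  assumes "monomial (expo a b c f) = (q :: (indet, 'k) mpoly)" "expo a b c f \<in> gen_exponents"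
    and "n = int (a + b + c + f)"
  shows "\<exists>m. m \<in> comp 1 \<and> m \<in> homog n \<and> d m = q \<cdot> e"
proof -
  have "q \<in> example_ideal"
    unfolding example_ideal_monomial mem_monomial_ideal_iff
    using assms(2) by (auto simp: monomial_def simp flip: assms(1))
  then obtain m where "m \<in> comp 1" "d m = q \<cdot> e" using exact_0 by (metis imageE imageI)
  moreover have "q \<cdot> e \<in> homog n"
    using homog_expo [OF e_in_homog] by (simp flip: assms(1) add: assms(3))
  ultimately show ?thesis using homogeneous_preimage by metis
qed

lemma vars_as_monomials:
  "vx = monomial (expo 1 0 0 0)" "vy = monomial (expo 0 1 0 0)"
  "vz = monomial (expo 0 0 1 0)" "vw = monomial (expo 0 0 0 1)"
  "vy * vz ^ 2 = monomial (expo 0 1 2 0)" "vy ^ 2 * vz = monomial (expo 0 2 1 0)"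
  unfolding power2_var unfolding var_def monomial_mult
  by (simp_all add: expo_def)

lemma lift_monomial_syzygy:
  assumes m: "m \<in> comp 1" "m \<in> homog p" "d m = f \<cdot> e"
    and m': "m' \<in> comp 1" "m' \<in> homog p'" "d m' = f' \<cdot> e"
    and r: "r = monomial (expo i j k l)" and r': "r' = monomial (expo i' j' k' l')"
    and "r * f = r' * f'" and "n = int (i + j + k + l) + p" and "n = int (i' + j' + k' + l') + p'"
  shows "\<exists>c. c \<in> comp 2 \<and> c \<in> homog n \<and> d c = r \<cdot> m - r' \<cdot> m'"
proof -
  have "r \<cdot> m - r' \<cdot> m' \<in> comp (Suc 0)"
    using m(1) m'(1) by (simp add: comp_diff comp_scale)
  moreover have "r \<cdot> m - r' \<cdot> m' \<in> homog n"
    unfolding r r' using assms m(2) m'(2) by (intro homog_diff homog_expo)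
  moreover have "d (r \<cdot> m - r' \<cdot> m') = 0"
    using assms by (simp add: d.diff d.scale)
  ultimately show ?thesis using lift_cycle by (metis numeral_2_eq_2)
qed

lemma ex_scarf_lift:
  "\<exists>a1 a2 a3 a4 a5 a12 a23 a34 a45 a14 a15 a24 a25.
    scarf_lift scale B hdeg tdeg e d a1 a2 a3 a4 a5 a12 a23 a34 a45 a14 a15 a24 a25"
proof -
  note gens = generators_as_monomials [symmetric] and mons = generators_as_monomials vars_as_monomials
  obtain a1 where a1: "a1 \<in> comp 1" "a1 \<in> homog 2" "d a1 = vx ^ 2 \<cdot> e"
    using lift_generator [OF gens(1), of 2] by (auto simp: gen_exponents_def)
  obtain a2 where a2: "a2 \<in> comp 1" "a2 \<in> homog 2" "d a2 = (vx * vy) \<cdot> e"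
    using lift_generator [OF gens(2), of 2] by (auto simp: gen_exponents_def)
  obtain a3 where a3: "a3 \<in> comp 1" "a3 \<in> homog 4" "d a3 = (vy ^ 2 * vz ^ 2) \<cdot> e"
    using lift_generator [OF gens(3), of 4] by (auto simp: gen_exponents_def)
  obtain a4 where a4: "a4 \<in> comp 1" "a4 \<in> homog 2" "d a4 = (vz * vw) \<cdot> e"
    using lift_generator [OF gens(4), of 2] by (auto simp: gen_exponents_def)
  obtain a5 where a5: "a5 \<in> comp 1" "a5 \<in> homog 2" "d a5 = vw ^ 2 \<cdot> e"
    using lift_generator [OF gens(5), of 2] by (auto simp: gen_exponents_def)
  note simps = power2_eq_square algebra_simps
  have "\<exists>c. c \<in> comp 2 \<and> c \<in> homog 3 \<and> d c = vx \<cdot> a2 - vy \<cdot> a1"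
    by (rule lift_monomial_syzygy [OF a2 a1 mons(6) mons(7)]) (simp_all add: simps)
  then obtain a12 where a12: "a12 \<in> comp 2" "a12 \<in> homog 3" "d a12 = vx \<cdot> a2 - vy \<cdot> a1" by blast
  have "\<exists>c. c \<in> comp 2 \<and> c \<in> homog 5 \<and> d c = vx \<cdot> a3 - (vy * vz ^ 2) \<cdot> a2"
    by (rule lift_monomial_syzygy [OF a3 a2 mons(6) mons(10)]) (simp_all add: simps)
  then obtain a23 where a23: "a23 \<in> comp 2" "a23 \<in> homog 5" "d a23 = vx \<cdot> a3 - (vy * vz ^ 2) \<cdot> a2" by blast
  have "\<exists>c. c \<in> comp 2 \<and> c \<in> homog 5 \<and> d c = (vy ^ 2 * vz) \<cdot> a4 - vw \<cdot> a3"
    by (rule lift_monomial_syzygy [OF a4 a3 mons(11) mons(9)]) (simp_all add: simps)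
  then obtain a34 where a34: "a34 \<in> comp 2" "a34 \<in> homog 5" "d a34 = (vy ^ 2 * vz) \<cdot> a4 - vw \<cdot> a3" by blast
  have "\<exists>c. c \<in> comp 2 \<and> c \<in> homog 3 \<and> d c = vz \<cdot> a5 - vw \<cdot> a4"
    by (rule lift_monomial_syzygy [OF a5 a4 mons(8) mons(9)]) (simp_all add: simps)
  then obtain a45 where a45: "a45 \<in> comp 2" "a45 \<in> homog 3" "d a45 = vz \<cdot> a5 - vw \<cdot> a4" by blast
  have "\<exists>c. c \<in> comp 2 \<and> c \<in> homog 4 \<and> d c = vx ^ 2 \<cdot> a4 - (vz * vw) \<cdot> a1"
    by (rule lift_monomial_syzygy [OF a4 a1 mons(1) mons(4)]) (simp_all add: simps)
  then obtain a14 where a14: "a14 \<in> comp 2" "a14 \<in> homog 4" "d a14 = vx ^ 2 \<cdot> a4 - (vz * vw) \<cdot> a1" by blast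
  have "\<exists>c. c \<in> comp 2 \<and> c \<in> homog 4 \<and> d c = vx ^ 2 \<cdot> a5 - vw ^ 2 \<cdot> a1"
    by (rule lift_monomial_syzygy [OF a5 a1 mons(1) mons(5)]) (simp_all add: simps)
  then obtain a15 where a15: "a15 \<in> comp 2" "a15 \<in> homog 4" "d a15 = vx ^ 2 \<cdot> a5 - vw ^ 2 \<cdot> a1" by blast
  have "\<exists>c. c \<in> comp 2 \<and> c \<in> homog 4 \<and> d c = (vx * vy) \<cdot> a4 - (vz * vw) \<cdot> a2"
    by (rule lift_monomial_syzygy [OF a4 a2 mons(2) mons(4)]) (simp_all add: simps)
  then obtain a24 where a24: "a24 \<in> comp 2" "a24 \<in> homog 4" "d a24 = (vx * vy) \<cdot> a4 - (vz * vw) \<cdot> a2" by blast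
  have "\<exists>c. c \<in> comp 2 \<and> c \<in> homog 4 \<and> d c = (vx * vy) \<cdot> a5 - vw ^ 2 \<cdot> a2"
    by (rule lift_monomial_syzygy [OF a5 a2 mons(2) mons(5)]) (simp_all add: simps)
  then obtain a25 where a25: "a25 \<in> comp 2" "a25 \<in> homog 4" "d a25 = (vx * vy) \<cdot> a5 - vw ^ 2 \<cdot> a2" by blast
  have "scarf_lift scale B hdeg tdeg e d a1 a2 a3 a4 a5 a12 a23 a34 a45 a14 a15 a24 a25"
    by unfold_locales (fact a1 a2 a3 a4 a5 a12 a23 a34 a45 a14 a15 a24 a25)+
  then show ?thesis by blast
qed

end

context scarf_lift
begin

abbreviation "combination_1 q1 q2 q3 q4 q5 \<equiv> q1 \<cdot> a1 + q2 \<cdot> a2 + q3 \<cdot> a3 + q4 \<cdot> a4 + q5 \<cdot> a5"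

abbreviation "combination_2 p12 p23 p34 p45 p14 p15 p24 p25 \<equiv>
  p12 \<cdot> a12 + p23 \<cdot> a23 + p34 \<cdot> a34 + p45 \<cdot> a45 +
  p14 \<cdot> a14 + p15 \<cdot> a15 + p24 \<cdot> a24 + p25 \<cdot> a25"

lemma mem_span_1_iff:
  "m \<in> span {a1, a2, a3, a4, a5} \<longleftrightarrow> (\<exists>q1 q2 q3 q4 q5. m = combination_1 q1 q2 q3 q4 q5)"
proof -
  have "m \<in> span {a1, a2, a3, a4, a5} \<longleftrightarrow>
      (\<exists>q1 q2 q3 q4 q5. m - q1 \<cdot> a1 - q2 \<cdot> a2 - q3 \<cdot> a3 - q4 \<cdot> a4 - q5 \<cdot> a5 = 0)"
    unfolding span_breakdown_eq span_empty by simp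
  moreover have "m - q1 \<cdot> a1 - q2 \<cdot> a2 - q3 \<cdot> a3 - q4 \<cdot> a4 - q5 \<cdot> a5 = m - combination_1 q1 q2 q3 q4 q5"
    for q1 q2 q3 q4 q5 by simp
  ultimately show ?thesis by (simp only: right_minus_eq)
qed

lemma mem_span_2_iff:
  "m \<in> span {a12, a23, a34, a45, a14, a15, a24, a25} \<longleftrightarrow>
    (\<exists>p12 p23 p34 p45 p14 p15 p24 p25. m = combination_2 p12 p23 p34 p45 p14 p15 p24 p25)"
proof -
  have "m \<in> span {a12, a23, a34, a45, a14, a15, a24, a25} \<longleftrightarrow>
      (\<exists>p12 p23 p34 p45 p14 p15 p24 p25. m - p12 \<cdot> a12 - p23 \<cdot> a23 - p34 \<cdot> a34 - p45 \<cdot> a45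
        - p14 \<cdot> a14 - p15 \<cdot> a15 - p24 \<cdot> a24 - p25 \<cdot> a25 = 0)"
    unfolding span_breakdown_eq span_empty by simp
  moreover have "m - p12 \<cdot> a12 - p23 \<cdot> a23 - p34 \<cdot> a34 - p45 \<cdot> a45
      - p14 \<cdot> a14 - p15 \<cdot> a15 - p24 \<cdot> a24 - p25 \<cdot> a25 =
      m - combination_2 p12 p23 p34 p45 p14 p15 p24 p25"
    for p12 p23 p34 p45 p14 p15 p24 p25 by simp
  ultimately show ?thesis by (simp only: right_minus_eq)
qed

lemma d_combination_1:
  "d (combination_1 q1 q2 q3 q4 q5) =
    (q1 * vx ^ 2 + q2 * (vx * vy) + q3 * (vy ^ 2 * vz ^ 2) + q4 * (vz * vw) + q5 * vw ^ 2) \<cdot> e"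
  by (simp add: d.add d.scale d_1 scale_left_distrib)

lemma d_combination_2:
  "d (combination_2 p12 p23 p34 p45 p14 p15 p24 p25) = combination_1
    (- (vy * p12 + vz * vw * p14 + vw ^ 2 * p15))
    (vx * p12 - vy * vz ^ 2 * p23 - vz * vw * p24 - vw ^ 2 * p25)
    (vx * p23 - vw * p34)
    (vy ^ 2 * vz * p34 - vw * p45 + vx ^ 2 * p14 + vx * vy * p24)
    (vz * p45 + vx ^ 2 * p15 + vx * vy * p25)"
  by (simp add: d.add d.scale d_2 algebra_simps)

lemma combination_1_in_comp: "combination_1 q1 q2 q3 q4 q5 \<in> comp 1"
  using comp_1 by (intro comp_add comp_scale)

text \<open>
  Two elements of \<open>F\<^sub>1\<close> with the same boundary differ by a boundary from \<open>F\<^sub>2\<close>, whose coordinates have no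
  constant term by minimality.  This is the hypothesis of \<open>graded_Nakayama\<close>, here and for \<open>F\<^sub>2\<close> below.
\<close>

lemma comp_1_eq_span: "comp 1 = span {a1, a2, a3, a4, a5}"
proof (rule graded_Nakayama)
  show "\<exists>k. g \<in> homog k" if "g \<in> {a1, a2, a3, a4, a5}" for g
    using that homog_1 by auto
  show "{a1, a2, a3, a4, a5} \<subseteq> comp 1" using comp_1 by simp
  fix m assume m: "m \<in> comp 1"
  obtain p where p: "p \<in> example_ideal" "d m = p \<cdot> e" using d_comp_1 [OF m] by blast
  obtain q1 q2 q3 q4 q5 where
    "p - q1 * vx ^ 2 - q2 * (vx * vy) - q3 * (vy ^ 2 * vz ^ 2) - q4 * (vz * vw) - q5 * vw ^ 2 = 0"
    using p(1) unfolding example_ideal_def ideal_gen_insert ideal_gen_empty by blast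
  then have p_eq: "p = q1 * vx ^ 2 + q2 * (vx * vy) + q3 * (vy ^ 2 * vz ^ 2) + q4 * (vz * vw) + q5 * vw ^ 2"
    by (simp add: algebra_simps)
  let ?n = "combination_1 q1 q2 q3 q4 q5"
  have "d (m - ?n) = 0" unfolding d.diff d_combination_1 p(2) p_eq by (rule diff_self)
  moreover have "m - ?n \<in> comp (Suc 0)"
    using comp_diff [OF m combination_1_in_comp] by simp
  ultimately have "m - ?n \<in> range d" using exact_Suc by blast
  then have "\<forall>b. Poly_Mapping.lookup (rep (m - ?n) b) 0 = 0" by (auto simp only: rep_d_no_constant)
  then show "\<exists>n\<in>span {a1, a2, a3, a4, a5}. \<forall>b. Poly_Mapping.lookup (rep (m - n) b) 0 = 0"
    unfolding bex_simps Bex_def mem_span_1_iff by blast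
qed

text \<open>
  The Scarf edges bound every cycle of \<open>F\<^sub>1\<close>: this is \<open>example_syzygies\<close>, transported along the lifts.
\<close>

lemma cycle_1:
  assumes "m \<in> comp 1" "d m = 0"
  shows "\<exists>n\<in>span {a12, a23, a34, a45, a14, a15, a24, a25}. d n = m"
proof -
  obtain q1 q2 q3 q4 q5 where m: "m = combination_1 q1 q2 q3 q4 q5"
    using assms(1) unfolding comp_1_eq_span mem_span_1_iff by blast
  have "(q1 * vx ^ 2 + q2 * (vx * vy) + q3 * (vy ^ 2 * vz ^ 2) + q4 * (vz * vw) + q5 * vw ^ 2) \<cdot> e = 0 \<cdot> e"
    using assms(2) unfolding m d_combination_1 by simp
  then have "q1 * vx ^ 2 + q2 * (vx * vy) + q3 * (vy ^ 2 * vz ^ 2) + q4 * (vz * vw) + q5 * vw ^ 2 = 0"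
    unfolding scale_e_eq_iff .
  from example_syzygies [OF this] obtain p12 p23 p34 p45 p14 p15 p24 p25 where q:
    "q1 = - (vy * p12 + vz * vw * p14 + vw ^ 2 * p15)"
    "q2 = vx * p12 - vy * vz ^ 2 * p23 - vz * vw * p24 - vw ^ 2 * p25"
    "q3 = vx * p23 - vw * p34"
    "q4 = vy ^ 2 * vz * p34 - vw * p45 + vx ^ 2 * p14 + vx * vy * p24"
    "q5 = vz * p45 + vx ^ 2 * p15 + vx * vy * p25"
    by (elim exE conjE)
  have "m = d (combination_2 p12 p23 p34 p45 p14 p15 p24 p25)"
    unfolding d_combination_2 m q by (rule refl)
  then show ?thesis unfolding Bex_def mem_span_2_iff by blast
qed

lemma comp_2_eq_span: "comp 2 = span {a12, a23, a34, a45, a14, a15, a24, a25}" (is "_ = span ?E")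
proof (rule graded_Nakayama)
  show "\<exists>k. g \<in> homog k" if "g \<in> ?E" for g
    using that homog_2 by auto
  show E: "?E \<subseteq> comp 2" using comp_2 by simp
  fix m assume m: "m \<in> comp 2"
  have "d m \<in> comp 1" "d (d m) = 0"
    using m d_in_comp [of m 1] d_d [of m 0] by (simp_all add: numeral_2_eq_2)
  then obtain n where n: "n \<in> span ?E" "d n = d m" using cycle_1 by blast
  have "n \<in> comp 2" using n(1) span_minimal [OF E subspace_comp] by blast
  then have "m - n \<in> comp (Suc (Suc 0))" using comp_diff [OF m] by (simp add: numeral_2_eq_2)
  then have "m - n \<in> range d" using exact_Suc [of "Suc 0"] n(2) d.diff [of m n] by auto
  then have "\<forall>b. Poly_Mapping.lookup (rep (m - n) b) 0 = 0" by (auto simp only: rep_d_no_constant)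
  then show "\<exists>n\<in>span ?E. \<forall>b. Poly_Mapping.lookup (rep (m - n) b) 0 = 0" using n(1) by blast
qed

lemma tdeg_2:
  assumes "b \<in> B" "hdeg b = 2"
  shows "3 \<le> tdeg b"
proof (rule tdeg_basis_bound [OF comp_2_eq_span _ assms])
  show "\<exists>k\<ge>3. g \<in> homog k" if "g \<in> {a12, a23, a34, a45, a14, a15, a24, a25}" for g
  proof -
    have "g \<in> homog 3 \<or> g \<in> homog 4 \<or> g \<in> homog 5" using that homog_2 by auto
    then show ?thesis
      by (elim disjE) (rule exI [of _ 3], simp, rule exI [of _ 4], simp, rule exI [of _ 5], simp)
  qed
qed

text \<open>
  No nonzero combination of the five generators over the field lies in the product of the maximal ideal and
  \<open>example_ideal\<close>, so by \<open>d_generator_coefficient\<close> no such combination of the \<open>ai\<close> has coordinates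
  without constant terms.  In particular \<open>a3\<close>, of degree \<open>4\<close>, has a nonzero constant coordinate at a basis
  element of degree \<open>4\<close>.  There the other four lifts, of degree \<open>2\<close>, have coordinate \<open>0\<close>, which forces
  \<open>q3 = 0\<close>.  The other four are constant vectors on the basis elements of degree \<open>2\<close>, so a relation
  between them splits, monomial by monomial of the \<open>qi\<close>, into relations over the field.
\<close>

lemma combination_1_independent:
  assumes comb: "combination_1 q1 q2 q3 q4 q5 = 0"
  shows "q1 = 0 \<and> q2 = 0 \<and> q3 = 0 \<and> q4 = 0 \<and> q5 = 0"
proof -
  have "\<exists>b. Poly_Mapping.lookup (rep a3 b) 0 \<noteq> 0"
  proof (rule ccontr)
    assume "\<nexists>b. Poly_Mapping.lookup (rep a3 b) 0 \<noteq> 0"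
    then have "Poly_Mapping.lookup (rep a3 b) 0 = 0" for b by blast
    moreover have "expo 0 2 2 0 \<in> gen_exponents" by (simp add: gen_exponents_def)
    ultimately have "Poly_Mapping.lookup (vy ^ 2 * vz ^ 2 :: (indet, 'k) mpoly) (expo 0 2 2 0) = 0"
      by (rule d_generator_coefficient [OF comp_1(3) _ d_1(3)])
    then show False unfolding generators_as_monomials(3) monomial_def by simp
  qed
  then obtain b where b: "Poly_Mapping.lookup (rep a3 b) 0 \<noteq> 0" by blast
  then have deg: "tdeg b = 4" using no_constant_off_degree [OF homog_1(3)] by blast
  have "rep (combination_1 q1 q2 q3 q4 q5) b = q3 * rep a3 b"
    using deg homog_1 by (simp add: rep_add rep_scale rep_above_degree [where n = 2])
  then have "q3 * Poly_Mapping.single 0 (Poly_Mapping.lookup (rep a3 b) 0) = 0"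
    unfolding comb rep_zero using rep_of_degree [OF homog_1(3) deg] by simp
  then have q3: "q3 = 0" using b mult_constant_eq_0 by blast
  have coefficients: "Poly_Mapping.lookup q1 t = 0 \<and> Poly_Mapping.lookup q2 t = 0 \<and>
      Poly_Mapping.lookup q4 t = 0 \<and> Poly_Mapping.lookup q5 t = 0" for t
  proof -
    let ?c = "\<lambda>q. Poly_Mapping.single 0 (Poly_Mapping.lookup q t) :: (indet, 'k) mpoly"
    let ?m = "combination_1 (?c q1) (?c q2) 0 (?c q4) (?c q5)"
    have "Poly_Mapping.lookup (rep ?m b) 0 = 0" for b
    proof (cases "tdeg b = 2")
      case True
      have const: "Poly_Mapping.lookup (q * rep a b) t = Poly_Mapping.lookup (?c q * rep a b) 0"
        if "a \<in> homog 2" for q a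
        by (subst (1 2) rep_of_degree [OF that True]) (simp only: lookup_mult_constant lookup_single_eq)
      have "Poly_Mapping.lookup (rep (combination_1 q1 q2 q3 q4 q5) b) t = Poly_Mapping.lookup (rep ?m b) 0"
        unfolding rep_add rep_scale lookup_add q3 by (simp add: const homog_1)
      then show ?thesis unfolding comb by (simp add: rep_zero)
    next
      case False
      have "?c q \<cdot> a \<in> homog 2" if "a \<in> homog 2" for q a
      proof -
        have "?c q \<cdot> a \<in> homog (0 + 2)"
          by (rule homog_scale [OF _ that]) (simp split: if_splits)
        then show ?thesis by simp
      qed
      then have "?m \<in> homog 2"
        using homog_1 by (simp add: homog_add)
      then show ?thesis using False no_constant_off_degree by blast
    qed
    then have "Poly_Mapping.lookup (?c q1 * vx ^ 2 + ?c q2 * (vx * vy) + 0 * (vy ^ 2 * vz ^ 2)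
        + ?c q4 * (vz * vw) + ?c q5 * vw ^ 2) s = 0" if "s \<in> gen_exponents" for s
      by (rule d_generator_coefficient [OF combination_1_in_comp _ d_combination_1 that])
    then have *: "\<forall>s\<in>gen_exponents. Poly_Mapping.lookup (?c q1 * vx ^ 2 + ?c q2 * (vx * vy)
        + ?c q4 * (vz * vw) + ?c q5 * vw ^ 2) s = 0"
      by simp
    then show ?thesis
      by (simp add: gen_exponents_def generators_as_monomials monomial_def mult_single lookup_add
        lookup_single expo_eq_iff when_def)
  qed
  then show ?thesis using q3 by (auto intro!: poly_mapping_eqI)
qed

text \<open>
  The boundary of a combination of edges has zero coordinates at \<open>a1\<close>, \<open>a3\<close> and \<open>a5\<close>.  In these three
  coordinates the edges \<open>12\<close>, \<open>23\<close>, \<open>34\<close>, \<open>45\<close> appear as \<open>y p12 \<in> (w)\<close>, \<open>x p23 = w p34\<close>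
  and \<open>z p45 \<in> (x)\<close>.
\<close>

lemma cycle_2_coefficients:
  assumes "m \<in> comp 2" "d m = 0"
  shows "\<exists>h12 h23 h45 p14 p15 p24 p25.
    m = combination_2 (vw * h12) (vw * h23) (vx * h23) (vx * h45) p14 p15 p24 p25"
proof -
  obtain p12 p23 p34 p45 p14 p15 p24 p25 where
    m: "m = combination_2 p12 p23 p34 p45 p14 p15 p24 p25"
    using assms(1) unfolding comp_2_eq_span mem_span_2_iff by blast
  have "combination_1
    (- (vy * p12 + vz * vw * p14 + vw ^ 2 * p15))
    (vx * p12 - vy * vz ^ 2 * p23 - vz * vw * p24 - vw ^ 2 * p25)
    (vx * p23 - vw * p34)
    (vy ^ 2 * vz * p34 - vw * p45 + vx ^ 2 * p14 + vx * vy * p24)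
    (vz * p45 + vx ^ 2 * p15 + vx * vy * p25) = 0"
    using assms(2) unfolding m d_combination_2 .
  from combination_1_independent [OF this]
  have c1: "vy * p12 + vz * vw * p14 + vw ^ 2 * p15 = 0" and c3: "vx * p23 - vw * p34 = 0"
    and c5: "vz * p45 + vx ^ 2 * p15 + vx * vy * p25 = 0"
    by (simp_all only: neg_equal_0_iff_equal)
  have "vy * p12 = vw * (- vz * p14 - vw * p15)"
  proof -
    have "vy * p12 - vw * (- vz * p14 - vw * p15) = vy * p12 + vz * vw * p14 + vw ^ 2 * p15"
      by (simp add: algebra_simps power2_eq_square)
    then show ?thesis unfolding c1 right_minus_eq .
  qed
  then obtain h12 where h12: "p12 = vw * h12" using var_syzygy [of Vy Vw] by blast
  have "vx * p23 = vw * p34" using c3 by simp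
  then obtain h23 where h23: "p23 = vw * h23" "p34 = vx * h23" using var_syzygy [of Vx Vw] by blast
  have "vz * p45 = vx * (- vx * p15 - vy * p25)"
  proof -
    have "vz * p45 - vx * (- vx * p15 - vy * p25) = vz * p45 + vx ^ 2 * p15 + vx * vy * p25"
      by (simp add: algebra_simps power2_eq_square)
    then show ?thesis unfolding c5 right_minus_eq .
  qed
  then obtain h45 where h45: "p45 = vx * h45" using var_syzygy [of Vz Vx] by blast
  show ?thesis using m unfolding h12 h23 h45 by blast
qed

text \<open>
  Suppose that a basis element \<open>b\<close> of \<open>F\<^sub>3\<close> has degree at most \<open>4\<close>.  By minimality its boundary involves
  only basis elements of \<open>F\<^sub>2\<close> of degree at most \<open>3\<close>, and these are combinations of \<open>a12\<close> and \<open>a45\<close>, the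
  only edges of that degree.  But no nontrivial combination of these two edges is a cycle: their
  boundaries involve disjoint pairs of the basis \<open>a1, \<dots>, a5\<close>.
\<close>

lemma tdeg_3:
  assumes b: "b \<in> B" "hdeg b = 3"
  shows "5 \<le> tdeg b"
proof (rule ccontr)
  assume "\<not> 5 \<le> tdeg b"
  have b_comp: "b \<in> comp (Suc (Suc (Suc 0)))"
    using basis_in_comp [OF b(1)] b(2) by (simp add: numeral_3_eq_3)
  have db: "d b \<in> comp 2"
    using d_in_comp [OF b_comp] by (simp add: numeral_2_eq_2)
  have db_homog: "d b \<in> homog (tdeg b)" using basis_in_homog [OF b(1)] d_homog by blast
  have "c \<in> span {a12, a45}" if c: "rep (d b) c \<noteq> 0" for c
  proof -
    obtain t where t: "Poly_Mapping.lookup (rep (d b) c) t \<noteq> 0"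
      using c by (metis poly_mapping_eqI lookup_zero)
    then have "t \<noteq> 0" using rep_d_no_constant by metis
    then have "tdeg c < tdeg b"
      using homogD [OF db_homog, of t c] t mdeg_eq_0_iff [of t] by (simp add: in_keys_iff)
    with \<open>\<not> 5 \<le> tdeg b\<close> have less: "tdeg c < 4" by simp
    have "c \<in> B" using c rep_notin by blast
    have "c \<in> comp 2"
      using c db \<open>c \<in> B\<close> basis_in_comp by (auto simp: mem_comp_iff)
    then have "homog_component (tdeg c) c \<in> span {a12, a45}"
      unfolding comp_2_eq_span
    proof (rule homog_component_in_span_low [rotated -1])
      show "g \<in> {a12, a45} \<or> (\<exists>k>tdeg c. g \<in> homog k)"
        if "g \<in> {a12, a23, a34, a45, a14, a15, a24, a25}" for g
      proof -
        have "g \<in> {a12, a45} \<or> g \<in> homog 4 \<or> g \<in> homog 5" using that homog_2 by auto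
        moreover have "tdeg c < 5" using less by simp
        ultimately show ?thesis using less by blast
      qed
      show "\<exists>k. g \<in> homog k" if "g \<in> {a12, a45}" for g using that homog_2 by auto
    qed
    then show ?thesis by (simp add: homog_component_of_homog [OF basis_in_homog [OF \<open>c \<in> B\<close>]])
  qed
  then have "(\<Sum>c | rep (d b) c \<noteq> 0. rep (d b) c \<cdot> c) \<in> span {a12, a45}"
    by (intro span_sum span_scale) simp
  then have "d b \<in> span {a12, a45}" by (simp only: sum_rep)
  then obtain l m where "d b - l \<cdot> a12 - m \<cdot> a45 = 0"
    unfolding span_breakdown_eq span_empty by blast
  then have lm: "d b = combination_2 l 0 0 m 0 0 0 0" by (simp add: algebra_simps)
  have "d (d b) = 0" by (rule d_d [OF b_comp])
  then have "combination_1 (- (vy * l)) (vx * l) 0 (- (vw * m)) (vz * m) = 0"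
    unfolding lm d_combination_2 by simp
  then have "vx * l = 0" "vz * m = 0" using combination_1_independent by blast+
  then have "l = 0" "m = 0" by (simp_all only: var_mult_cancel)
  then have "d b = 0" using lm by simp
  then show False using basis_not_cycle [OF b(1), of 2] b(2) by (simp add: numeral_3_eq_3)
qed

lemma cycle_2_degree_4:
  assumes "m \<in> comp 2" "m \<in> homog 4" "d m = 0"
  shows "m = 0"
proof -
  have "m \<in> comp (Suc 1)" using assms(1) by (simp add: numeral_2_eq_2)
  then obtain m' where m': "m' \<in> comp (Suc (Suc 1))" "m' \<in> homog 4" "d m' = m"
    using lift_cycle assms(2,3) by blast
  have "m' \<in> comp 3" using m'(1) by (simp add: numeral_3_eq_3)
  then have "m' = 0" using m'(2) by (rule eq_0_below_tdeg) (use tdeg_3 in fastforce)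
  then show ?thesis using m'(3) by simp
qed

lemma degree_4_determined_by_boundary:
  assumes "m \<in> comp 2" "m \<in> homog 4" "n \<in> comp 2" "n \<in> homog 4" "d m = d n"
  shows "m = n"
  using cycle_2_degree_4 [of "m - n"] assms by (simp add: comp_diff homog_diff d.diff)

end

section \<open>The obstruction to associativity\<close>

locale scarf_dga = scarf_lift +
  fixes mul :: "'b \<Rightarrow> 'b \<Rightarrow> 'b" (infixl "\<star>" 70)
  assumes dga: "dga_structure mul" and graded: "respects_standard_grading mul"
begin

lemma mul_hom_right: "module_hom scale scale (\<lambda>b. a \<star> b)"
  and mul_hom_left: "module_hom scale scale (\<lambda>a. a \<star> b)"
  using dga unfolding dga_structure_def by blast+

lemmas mul_right = module_hom.add [OF mul_hom_right] module_hom.diff [OF mul_hom_right]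
    module_hom.scale [OF mul_hom_right] module_hom.zero [OF mul_hom_right]
  and mul_left = module_hom.add [OF mul_hom_left] module_hom.diff [OF mul_hom_left]
    module_hom.scale [OF mul_hom_left] module_hom.zero [OF mul_hom_left]

lemma mul_e: "e \<star> a = a" "a \<star> e = a"
  using dga unfolding dga_structure_def by blast+

lemma mul_assoc: "(a \<star> b) \<star> c = a \<star> (b \<star> c)"
  using dga unfolding dga_structure_def by blast

lemma leibniz: "a \<in> comp i \<Longrightarrow> b \<in> comp j \<Longrightarrow> d (a \<star> b) = d a \<star> b + (- 1) ^ i \<cdot> (a \<star> d b)"
  using dga unfolding dga_structure_def by blast

lemma mul_comp: "a \<in> comp i \<Longrightarrow> b \<in> comp j \<Longrightarrow> a \<star> b \<in> comp (i + j)"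
  using dga unfolding dga_structure_def by blast

lemma mul_homog: "a \<in> homog n \<Longrightarrow> b \<in> homog k \<Longrightarrow> a \<star> b \<in> homog (n + k)"
  using graded unfolding respects_standard_grading_def by blast

lemma d_mul_1_1:
  assumes "a \<in> comp 1" "b \<in> comp 1" "d a = f \<cdot> e" "d b = g \<cdot> e"
  shows "d (a \<star> b) = f \<cdot> b - g \<cdot> a"
  using leibniz [OF assms(1,2)] by (simp add: assms(3,4) mul_left mul_right mul_e)

lemma mul_1_1_in_comp: "a \<in> comp 1 \<Longrightarrow> b \<in> comp 1 \<Longrightarrow> a \<star> b \<in> comp 2"
  using mul_comp [of a 1 b 1] by (simp add: numeral_2_eq_2)

text \<open>
  Since \<open>F\<^sub>2\<close> has no nonzero cycle of degree \<open>4\<close>, products of lifts of quadrics are determined by the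
  Leibniz rule.
\<close>

lemma mul_1_1_eq:
  assumes a: "a \<in> comp 1" "a \<in> homog 2" "d a = f \<cdot> e" and b: "b \<in> comp 1" "b \<in> homog 2" "d b = g \<cdot> e"
    and c: "c \<in> comp 2" "c \<in> homog 4" "d c = f \<cdot> b - g \<cdot> a"
  shows "a \<star> b = c"
proof (rule degree_4_determined_by_boundary)
  show "a \<star> b \<in> comp 2" using a(1) b(1) by (rule mul_1_1_in_comp)
  show "a \<star> b \<in> homog 4" using mul_homog [OF a(2) b(2)] by simp
  show "d (a \<star> b) = d c" unfolding c(3) using a(1) b(1) a(3) b(3) by (rule d_mul_1_1)
qed (fact c)+

lemma a1_a2: "a1 \<star> a2 = vx \<cdot> a12"
proof (rule mul_1_1_eq [OF comp_1(1) homog_1(1) d_1(1) comp_1(2) homog_1(2) d_1(2)])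
  show "vx \<cdot> a12 \<in> homog 4" using homog_var [OF homog_2(1), of Vx] by simp
qed (simp_all add: comp_2 comp_scale d.scale d_2 algebra_simps power2_eq_square)

lemma a4_a5: "a4 \<star> a5 = vw \<cdot> a45"
proof (rule mul_1_1_eq [OF comp_1(4) homog_1(4) d_1(4) comp_1(5) homog_1(5) d_1(5)])
  show "vw \<cdot> a45 \<in> homog 4" using homog_var [OF homog_2(4), of Vw] by simp
qed (simp_all add: comp_2 comp_scale d.scale d_2 algebra_simps power2_eq_square)

lemma products_eq_edges:
  "a1 \<star> a4 = a14" "a1 \<star> a5 = a15" "a2 \<star> a4 = a24" "a2 \<star> a5 = a25"
  using comp_1 comp_2 homog_1 homog_2 d_1 d_2 by (auto intro!: mul_1_1_eq)

lemma a1_a1: "a1 \<star> a1 = 0"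
  using comp_1(1) homog_1(1) d_1(1) subspace_0 [OF subspace_comp]
  by (intro mul_1_1_eq) (auto simp: homog_def rep_zero)

lemma a5_a5: "a5 \<star> a5 = 0"
  using comp_1(5) homog_1(5) d_1(5) subspace_0 [OF subspace_comp]
  by (intro mul_1_1_eq) (auto simp: homog_def rep_zero)

text \<open>
  The products of \<open>a12\<close>, \<open>a23\<close>, \<open>a34\<close> and \<open>a45\<close> with \<open>a5\<close> may be anything, but their coefficients in a
  cycle are multiples of \<open>x\<close> or \<open>w\<close>.  Of the remaining edges, \<open>a14 * a5\<close> and \<open>a24 * a5\<close> contain the
  product \<open>a4 * a5 = w a45\<close>, and \<open>a15 * a5\<close> and \<open>a25 * a5\<close> contain \<open>a5 * a5 = 0\<close>.
\<close>

lemma cycle_mul_a5: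
  assumes "m \<in> comp 2" "d m = 0"
  shows "\<exists>f g. m \<star> a5 = vx \<cdot> f + vw \<cdot> g"
proof -
  obtain h12 h23 h45 p14 p15 p24 p25 where
    m: "m = combination_2 (vw * h12) (vw * h23) (vx * h23) (vx * h45) p14 p15 p24 p25"
    using cycle_2_coefficients [OF assms] by blast
  have 14: "a14 \<star> a5 = vw \<cdot> (a1 \<star> a45)" and 15: "a15 \<star> a5 = 0"
    and 24: "a24 \<star> a5 = vw \<cdot> (a2 \<star> a45)" and 25: "a25 \<star> a5 = 0"
    by (simp_all only: products_eq_edges [symmetric] mul_assoc a4_a5 a5_a5 mul_right)
  have "m \<star> a5 = vx \<cdot> (h23 \<cdot> (a34 \<star> a5) + h45 \<cdot> (a45 \<star> a5)) +
    vw \<cdot> (h12 \<cdot> (a12 \<star> a5) + h23 \<cdot> (a23 \<star> a5) + p14 \<cdot> (a1 \<star> a45) + p24 \<cdot> (a2 \<star> a45))"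
    unfolding m by (simp add: mul_left 14 15 24 25 algebra_simps)
  then show ?thesis by blast
qed

text \<open>
  The mirror image of \<open>cycle_mul_a5\<close> under the symmetry of the ideal that exchanges \<open>x\<close> with \<open>w\<close> and
  \<open>y\<close> with \<open>z\<close>.
\<close>

lemma a1_mul_cycle:
  assumes "m \<in> comp 2" "d m = 0"
  shows "\<exists>f g. a1 \<star> m = vx \<cdot> f + vw \<cdot> g"
proof -
  obtain h12 h23 h45 p14 p15 p24 p25 where
    m: "m = combination_2 (vw * h12) (vw * h23) (vx * h23) (vx * h45) p14 p15 p24 p25"
    using cycle_2_coefficients [OF assms] by blast
  have 14: "a1 \<star> a14 = 0" and 15: "a1 \<star> a15 = 0"
    and 24: "a1 \<star> a24 = vx \<cdot> (a12 \<star> a4)" and 25: "a1 \<star> a25 = vx \<cdot> (a12 \<star> a5)"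
    by (simp_all only: products_eq_edges [symmetric] mul_assoc [symmetric] a1_a2 a1_a1 mul_left)
  have "a1 \<star> m = vx \<cdot> (h23 \<cdot> (a1 \<star> a34) + h45 \<cdot> (a1 \<star> a45) + p24 \<cdot> (a12 \<star> a4) + p25 \<cdot> (a12 \<star> a5)) +
    vw \<cdot> (h12 \<cdot> (a1 \<star> a12) + h23 \<cdot> (a1 \<star> a23))"
    unfolding m by (simp add: mul_right 14 15 24 25 algebra_simps)
  then show ?thesis by blast
qed

lemma a12_mul_a5: "a12 \<star> a5 = 0"
proof (rule eq_0_by_constant_coefficients [where n = 5 and i = 3])
  show "a12 \<star> a5 \<in> comp 3" using mul_comp [OF comp_2(1) comp_1(5)] by simp
  show "a12 \<star> a5 \<in> homog 5" using mul_homog [OF homog_2(1) homog_1(5)] by simp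
  show "5 \<le> tdeg b" if "b \<in> B" "hdeg b = 3" for b using tdeg_3 that by blast
  fix b
  \<comment> \<open>The deviations of \<open>a1 * a3\<close> and \<open>a3 * a5\<close> from their values in a multigraded algebra.\<close>
  define X where "X = a1 \<star> a3 - vx \<cdot> a23 - (vy * vz ^ 2) \<cdot> a12"
  define Y where "Y = a3 \<star> a5 - vw \<cdot> a34 - (vy ^ 2 * vz) \<cdot> a45"
  have "X \<in> comp 2" "Y \<in> comp 2"
    unfolding X_def Y_def using comp_1 comp_2 by (auto intro!: comp_diff comp_scale mul_1_1_in_comp)
  moreover have "d X = 0" "d Y = 0"
    unfolding X_def Y_def
    by (simp_all add: d.diff d.add d.scale d_2 d_mul_1_1 [OF comp_1(1) comp_1(3) d_1(1) d_1(3)]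
      d_mul_1_1 [OF comp_1(3) comp_1(5) d_1(3) d_1(5)] algebra_simps power2_eq_square)
  ultimately obtain f g f' g' where X5: "X \<star> a5 = vx \<cdot> f + vw \<cdot> g" and Y1: "a1 \<star> Y = vx \<cdot> f' + vw \<cdot> g'"
    using cycle_mul_a5 a1_mul_cycle by metis
  have "X + vx \<cdot> a23 + (vy * vz ^ 2) \<cdot> a12 = a1 \<star> a3" "Y + vw \<cdot> a34 + (vy ^ 2 * vz) \<cdot> a45 = a3 \<star> a5"
    unfolding X_def Y_def by simp_all
  then have "(X + vx \<cdot> a23 + (vy * vz ^ 2) \<cdot> a12) \<star> a5 = a1 \<star> (Y + vw \<cdot> a34 + (vy ^ 2 * vz) \<cdot> a45)"
    by (simp only: mul_assoc)
  then have "vx \<cdot> f + vw \<cdot> g + vx \<cdot> (a23 \<star> a5) + (vy * vz ^ 2) \<cdot> (a12 \<star> a5) =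
      vx \<cdot> f' + vw \<cdot> g' + vw \<cdot> (a1 \<star> a34) + (vy ^ 2 * vz) \<cdot> (a1 \<star> a45)"
    by (simp only: mul_left mul_right X5 Y1)
  from arg_cong [OF this, of "\<lambda>m. rep m b"]
  have eq: "vx * rep f b + vw * rep g b + vx * rep (a23 \<star> a5) b + vy * (vz * (vz * rep (a12 \<star> a5) b)) =
      vx * rep f' b + vw * rep g' b + vw * rep (a1 \<star> a34) b + vy * (vy * (vz * rep (a1 \<star> a45) b))"
    by (simp only: rep_add rep_scale mult.assoc power2_eq_square)
  \<comment> \<open>At the monomial \<open>yz\<^sup>2\<close> every summand of \<open>eq\<close> other than \<open>yz\<^sup>2 (a12 * a5)\<close> has coefficient \<open>0\<close>,
    being a multiple of \<open>x\<close>, \<open>w\<close> or \<open>y\<^sup>2\<close>.\<close>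
  have zero: "expo 0 (Suc 0) 2 0 - Poly_Mapping.single Vy (Suc 0) - Poly_Mapping.single Vz (Suc 0)
      - Poly_Mapping.single Vz (Suc 0) = 0"
    by (simp add: poly_mapping_eq_iff fun_eq_iff all_indet lookup_minus lookup_single)
  show "Poly_Mapping.lookup (rep (a12 \<star> a5) b) 0 = 0"
    using arg_cong [OF eq, of "\<lambda>p. Poly_Mapping.lookup p (expo 0 1 2 0)"]
    by (simp add: lookup_add lookup_var_mult lookup_minus lookup_single zero)
qed

text \<open>
  In the boundary of \<open>a12 * a5 = 0\<close> the first two terms are multiples of \<open>x\<close> and \<open>y\<close>, and \<open>a12\<close> has
  constant coordinates, so the coefficients of \<open>w\<^sup>2\<close> are exactly those coordinates.
\<close>

lemma contradiction: False
proof -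
  have "d (a12 \<star> a5) = (vx \<cdot> a2 - vy \<cdot> a1) \<star> a5 + vw ^ 2 \<cdot> a12"
    using leibniz [OF comp_2(1) comp_1(5)] by (simp add: d_2 d_1 mul_right mul_e)
  then have eq: "vx \<cdot> (a2 \<star> a5) - vy \<cdot> (a1 \<star> a5) + vw ^ 2 \<cdot> a12 = 0"
    unfolding a12_mul_a5 mul_left by simp
  have "a12 = 0"
  proof (rule eq_0_by_constant_coefficients [OF comp_2(1) homog_2(1) tdeg_2])
    fix b
    have "rep (vx \<cdot> (a2 \<star> a5) - vy \<cdot> (a1 \<star> a5) + vw ^ 2 \<cdot> a12) b = 0"
      unfolding eq rep_zero ..
    then have *: "vx * rep (a2 \<star> a5) b - vy * rep (a1 \<star> a5) b + vw * (vw * rep a12 b) = 0"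
      by (simp add: rep_add rep_diff rep_scale power2_eq_square mult.assoc)
    have zero: "expo 0 0 0 2 - Poly_Mapping.single Vw (Suc 0) - Poly_Mapping.single Vw (Suc 0) = 0"
      by (simp add: poly_mapping_eq_iff fun_eq_iff all_indet lookup_minus lookup_single)
    show "Poly_Mapping.lookup (rep a12 b) 0 = 0"
      using arg_cong [OF *, of "\<lambda>p. Poly_Mapping.lookup p (expo 0 0 0 2)"]
      by (simp add: lookup_add lookup_minus lookup_var_mult lookup_single zero)
  qed
  then have "combination_1 (- vy) vx 0 0 0 = 0" using d_2(1) by simp
  then have "(vx :: (indet, 'a) mpoly) = 0" using combination_1_independent by blast
  moreover have "Poly_Mapping.lookup (vx :: (indet, 'a) mpoly) (Poly_Mapping.single Vx 1) = 1"
    by (simp add: var_def monomial_def)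
  ultimately show False by simp
qed

end

theorem theorem5p1:
  fixes I :: "(indet, 'k::field) mpoly set"
  assumes "I = ideal_gen {var Vx ^ 2, var Vx * var Vy, var Vy ^ 2 * var Vz ^ 2,
                          var Vz * var Vw, var Vw ^ 2}"
  shows "strongly_generic I \<and>
    (\<forall>(scale :: (indet, 'k) mpoly \<Rightarrow> 'm::ab_group_add \<Rightarrow> 'm) B hdeg tdeg e d.
       minimal_graded_free_resolution scale B hdeg tdeg e d I \<longrightarrow>
       \<not> (\<exists>mul. minimal_graded_free_resolution.dga_structure scale B hdeg e d mul \<and>
                minimal_graded_free_resolution.respects_standard_grading scale B tdeg mul))"
proof (intro conjI allI impI notI)
  have I: "I = example_ideal" using assms by (simp add: example_ideal_def)
  show "strongly_generic I" unfolding I by (rule example_ideal_strongly_generic)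
  fix scale :: "(indet, 'k) mpoly \<Rightarrow> 'm \<Rightarrow> 'm" and B hdeg tdeg e d
  assume "minimal_graded_free_resolution scale B hdeg tdeg e d I"
  then have res: "example_resolution scale B hdeg tdeg e d"
    unfolding I example_resolution_def .
  assume "\<exists>mul. minimal_graded_free_resolution.dga_structure scale B hdeg e d mul \<and>
    minimal_graded_free_resolution.respects_standard_grading scale B tdeg mul"
  then obtain mul where mul: "minimal_graded_free_resolution.dga_structure scale B hdeg e d mul"
      "minimal_graded_free_resolution.respects_standard_grading scale B tdeg mul"
    by blast
  obtain a1 a2 a3 a4 a5 a12 a23 a34 a45 a14 a15 a24 a25 where
    "scarf_lift scale B hdeg tdeg e d a1 a2 a3 a4 a5 a12 a23 a34 a45 a14 a15 a24 a25"
    using example_resolution.ex_scarf_lift [OF res] by blast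
  then have "scarf_dga scale B hdeg tdeg e d a1 a2 a3 a4 a5 a12 a23 a34 a45 a14 a15 a24 a25 mul"
    using mul by (intro scarf_dga.intro scarf_dga_axioms.intro)
  then show False by (rule scarf_dga.contradiction)
qed

end
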